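(* A graded Hopf operad $\mathcal{D}$ (with composition map $\gamma$) is also a Hopf algebra, with its given coalgebra structure and with product $$a\cdot b:=\gamma\bigl(b\otimes\Delta^{(n)}a\bigr)\qquad\text{for } a\in\mathcal{D},\ b\in\mathcal{D}_n,$$ where $\Delta^{(n)}$ is the iterated coproduct from $\mathcal{D}$ to $\mathcal{D}^{\otimes(n+1)}$.
   Context: $\mathbb{K}$ is a field of characteristic zero. A graded coalgebra is a vector space $\mathcal{C}=\bigoplus_{n\ge0}\mathcal{C}_n$ with a degree-preserving coassociative coproduct $\Delta$ and a counit $\varepsilon$ vanishing in positive degrees; $|c|=n$ for $c\in\mathcal{C}_n$; $\Delta(c)=\sum_{(c)}c'\otimes c''$. It is connected if $\mathcal{C}_0=\mathbb{K}$; then $1\in\mathcal{C}_0$ is the element with $\varepsilon(1)=1$. The composition of graded coalgebras $\mathcal{C},\mathcal{D}$ is $\mathcal{D}\circ\mathcal{C}=\bigoplus_{n\ge0}\mathcal{D}_n\otimes\mathcal{C}^{\otimes(n+1)}$, with $d\otimes c_0\otimes\dotsb\otimes c_n$ ($d\in\mathcal{D}_n$) written $d\circ(c_0\cdot\dotsb\cdot c_n)$ and of total degree $|d|+|c_0|+\dotsb+|c_n|$; the coproduct is $$\Delta\bigl(d\circ(c_0\cdot\dotsb\cdot c_n)\bigr)=\sum_{i=0}^n\ \sum_{(d),\,|d'|=i}\ \sum_{(c_i)} \bigl(d'\circ(c_0\cdot\dotsb\cdot c_{i-1}\cdot c_i')\bigr)\otimes\bigl(d''\circ(c_i''\cdot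 c_{i+1}\cdot\dotsb\cdot c_n)\bigr)$$ (the sum over $(d)$ with $|d'|=i$ is over the component of $\Delta(d)$ in $\mathcal{D}_i\otimes\mathcal{D}_{n-i}$), with counit $\varepsilon(d\circ(c_0\cdot\dotsb\cdot c_n))=\varepsilon(d)\prod_j\varepsilon(c_j)$. A graded Hopf operad is a monoid in the category of connected graded coalgebras with respect to $\circ$: a connected graded coalgebra $\mathcal{D}$ with a morphism of graded coalgebras $\gamma\colon\mathcal{D}\circ\mathcal{D}\to\mathcal{D}$ (with $\mathcal{D}\circ\mathcal{D}$ graded by total degree), so $\Delta_{\mathcal D}\gamma=(\gamma\otimes\gamma)\Delta_{\mathcal D\circ\mathcal D}$, which is associative, $$\gamma\bigl(\gamma(d\otimes d_0\otimes\dotsb\otimes d_n)\otimes e_{0,0}\otimes\dotsb\otimes e_{n,|d_n|}\bigr)=\gamma\bigl(d\otimes\gamma(d_0\otimes e_{0,0}\otimes\dotsb\otimes e_{0,|d_0|})\otimes\dotsb\otimes\gamma(d_n\otimes e_{n,0}\otimes\dotsb\otimes e_{n,|d_n|})\bigr)$$ for $d\in\mathcal{D}_n$, homogeneous $d_0,\dots,d_n$ and $e_{i,j}\in\mathcal{D}$ ($0\le i\le n$, $0\le j\le|d_i|$), and unital, $\gamma(1\otimes d)=d$ and $\gamma(d\otimes1^{\otimes(|d|+1)})=d$ for homogeneous $d$. *)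

theory Defs
  imports Complex_Main "HOL-Library.Poly_Mapping"
begin

definition fscale :: "'k::field \<Rightarrow> ('x \<Rightarrow>\<^sub>0 'k) \<Rightarrow> ('x \<Rightarrow>\<^sub>0 'k)" where
  "fscale c t = Poly_Mapping.map ((*) c) t"

lemma lookup_fscale: "Poly_Mapping.lookup (fscale c t) x = c * Poly_Mapping.lookup t x"
  by (simp add: fscale_def Poly_Mapping.map.rep_eq when_def)

global_interpretation formal: vector_space "fscale :: 'k::field \<Rightarrow> ('x \<Rightarrow>\<^sub>0 'k) \<Rightarrow> ('x \<Rightarrow>\<^sub>0 'k)"
  by unfold_locales
    (auto intro!: poly_mapping_eqI simp: lookup_fscale lookup_add algebra_simps)

definition lin_ext :: "('k::field \<Rightarrow> 'w \<Rightarrow> 'w) \<Rightarrow> ('x \<Rightarrow> 'w) \<Rightarrow> ('x \<Rightarrow>\<^sub>0 'k) \<Rightarrow> 'w::ab_group_add" where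
  "lin_ext s f t = (\<Sum>x\<in>Poly_Mapping.keys t. s (Poly_Mapping.lookup t x) (f x))"

abbreviation pure :: "'x \<Rightarrow> ('x \<Rightarrow>\<^sub>0 'k::field)" where
  "pure x \<equiv> Poly_Mapping.single x 1"

text \<open>
  The list \<open>[v\<^sub>1, \<dots>, v\<^sub>n]\<close> stands for the pure tensor \<open>v\<^sub>1 \<otimes> \<dots> \<otimes> v\<^sub>n\<close>. The \<open>n\<close>-th tensor power of
  a vector space \<open>V\<close> is the space of formal combinations of lists of length \<open>n\<close> modulo the span
  of the multilinearity relations. Elements of tensor powers are handled through representatives
  (Sweedler sums), and an equation between tensors is \<open>tensor_eq\<close>.
\<close>

definition tensors :: "nat \<Rightarrow> ('v list \<Rightarrow>\<^sub>0 'k::field) set" where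
  "tensors n = {t. \<forall>xs\<in>Poly_Mapping.keys t. length xs = n}"

definition multilinearity_relations ::
    "('k::field \<Rightarrow> 'v::ab_group_add \<Rightarrow> 'v) \<Rightarrow> ('v list \<Rightarrow>\<^sub>0 'k) set" where
  "multilinearity_relations s =
     {pure (xs @ (x + y) # zs) - pure (xs @ x # zs) - pure (xs @ y # zs) | xs x y zs. True} \<union>
     {pure (xs @ s c x # zs) - fscale c (pure (xs @ x # zs)) | xs c x zs. True}"

definition tensor_eq ::
    "('k::field \<Rightarrow> 'v::ab_group_add \<Rightarrow> 'v) \<Rightarrow> ('v list \<Rightarrow>\<^sub>0 'k) \<Rightarrow> ('v list \<Rightarrow>\<^sub>0 'k) \<Rightarrow> bool" where
  "tensor_eq s t u \<longleftrightarrow> t - u \<in> formal.span (multilinearity_relations s)"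

definition tprod :: "('v list \<Rightarrow>\<^sub>0 'k::field) \<Rightarrow> ('v list \<Rightarrow>\<^sub>0 'k) \<Rightarrow> ('v list \<Rightarrow>\<^sub>0 'k)" where
  "tprod t u = lin_ext fscale (\<lambda>xs. lin_ext fscale (\<lambda>ys. pure (xs @ ys)) u) t"

text \<open>
  \<open>Delta x\<close> is a representative in \<open>tensors 2\<close> of the coproduct of \<open>x\<close>; accordingly linearity,
  coassociativity etc. are required only up to \<open>tensor_eq\<close>.
\<close>

locale coalgebra = vector_space scale
  for scale :: "'k::field_char_0 \<Rightarrow> 'v::ab_group_add \<Rightarrow> 'v" +
  fixes Delta :: "'v \<Rightarrow> ('v list \<Rightarrow>\<^sub>0 'k)"
    and eps :: "'v \<Rightarrow> 'k"
  assumes Delta_tensor: "Delta x \<in> tensors 2"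
    and Delta_add: "tensor_eq scale (Delta (x + y)) (Delta x + Delta y)"
    and Delta_scale: "tensor_eq scale (Delta (scale c x)) (fscale c (Delta x))"
    and coassoc: "tensor_eq scale
        (lin_ext fscale (\<lambda>p. tprod (Delta (p ! 0)) (pure [p ! 1])) (Delta x))
        (lin_ext fscale (\<lambda>p. tprod (pure [p ! 0]) (Delta (p ! 1))) (Delta x))"
    and eps_linear: "Vector_Spaces.linear scale (*) eps"
    and counit_left: "lin_ext scale (\<lambda>p. scale (eps (p ! 0)) (p ! 1)) (Delta x) = x"
    and counit_right: "lin_ext scale (\<lambda>p. scale (eps (p ! 1)) (p ! 0)) (Delta x) = x"

text \<open>\<open>iter_coproduct Delta n\<close> maps into the tensor power with \<open>n + 1\<close> factors.\<close>

fun iter_coproduct :: "('v \<Rightarrow> ('v list \<Rightarrow>\<^sub>0 'k::field)) \<Rightarrow> nat \<Rightarrow> 'v \<Rightarrow> ('v list \<Rightarrow>\<^sub>0 'k)" where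
  "iter_coproduct Delta 0 x = pure [x]"
| "iter_coproduct Delta (Suc n) x =
     lin_ext fscale (\<lambda>p. tprod (iter_coproduct Delta n (p ! 0)) (pure [p ! 1])) (Delta x)"

definition is_decomposition :: "(nat \<Rightarrow> 'v::ab_group_add set) \<Rightarrow> 'v \<Rightarrow> (nat \<Rightarrow> 'v) \<Rightarrow> bool" where
  "is_decomposition C x f \<longleftrightarrow>
     (\<forall>n. f n \<in> C n) \<and> finite {n. f n \<noteq> 0} \<and> x = (\<Sum>n | f n \<noteq> 0. f n)"

definition component :: "(nat \<Rightarrow> 'v::ab_group_add set) \<Rightarrow> nat \<Rightarrow> 'v \<Rightarrow> 'v" where
  "component C n x = (THE f. is_decomposition C x f) n"

locale graded_coalgebra = coalgebra scale Delta eps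
  for scale :: "'k::field_char_0 \<Rightarrow> 'v::ab_group_add \<Rightarrow> 'v"
    and C :: "nat \<Rightarrow> 'v set"
    and Delta :: "'v \<Rightarrow> ('v list \<Rightarrow>\<^sub>0 'k)"
    and eps :: "'v \<Rightarrow> 'k" +
  assumes C_subspace: "subspace (C n)"
    and C_direct_sum: "\<exists>!f. is_decomposition C x f"
    and Delta_degree: "x \<in> C n \<Longrightarrow>
        \<exists>t. tensor_eq scale (Delta x) t \<and>
          Poly_Mapping.keys t \<subseteq> {[y, z] | y z i. i \<le> n \<and> y \<in> C i \<and> z \<in> C (n - i)}"
    and eps_degree: "x \<in> C n \<Longrightarrow> n > 0 \<Longrightarrow> eps x = 0"

locale connected_graded_coalgebra = graded_coalgebra scale C Delta eps
  for scale :: "'k::field_char_0 \<Rightarrow> 'v::ab_group_add \<Rightarrow> 'v"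
    and C :: "nat \<Rightarrow> 'v set"
    and Delta :: "'v \<Rightarrow> ('v list \<Rightarrow>\<^sub>0 'k)"
    and eps :: "'v \<Rightarrow> 'k" +
  assumes connected: "dim (C 0) = 1"

definition unit_elem :: "(nat \<Rightarrow> 'v set) \<Rightarrow> ('v \<Rightarrow> 'k::field) \<Rightarrow> 'v" where
  "unit_elem C eps = (THE x. x \<in> C 0 \<and> eps x = 1)"

text \<open>
  The pair \<open>(d, [c\<^sub>0, \<dots>, c\<^sub>n])\<close> with \<open>d\<close> in degree \<open>n\<close> stands for \<open>d \<circ> (c\<^sub>0 \<cdot> \<dots> \<cdot> c\<^sub>n)\<close>, so \<open>n\<close> is one less
  than the length of the list. Applying \<open>component D i\<close> and \<open>component D (n - i)\<close> to the two
  factors of \<open>Delta d\<close> extracts its part in \<open>D i \<otimes> D (n - i)\<close>.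
\<close>

definition comp_coproduct ::
    "(nat \<Rightarrow> 'd set) \<Rightarrow> ('d \<Rightarrow> ('d list \<Rightarrow>\<^sub>0 'k)) \<Rightarrow> ('c \<Rightarrow> ('c list \<Rightarrow>\<^sub>0 'k)) \<Rightarrow>
     'd::ab_group_add \<Rightarrow> 'c list \<Rightarrow> (('d \<times> 'c list) \<times> ('d \<times> 'c list)) \<Rightarrow>\<^sub>0 'k::field" where
  "comp_coproduct D Delta_D Delta_C d cs =
     (\<Sum>i<length cs.
        lin_ext fscale (\<lambda>p.
          lin_ext fscale (\<lambda>q.
            pure ((component D i (p ! 0), take i cs @ [q ! 0]),
                  (component D (length cs - 1 - i) (p ! 1), q ! 1 # drop (Suc i) cs)))
            (Delta_C (cs ! i)))
          (Delta_D d))"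

definition comp_counit :: "('d \<Rightarrow> 'k) \<Rightarrow> ('c \<Rightarrow> 'k) \<Rightarrow> 'd \<Rightarrow> 'c list \<Rightarrow> 'k::field" where
  "comp_counit eps_D eps_C d cs = eps_D d * prod_list (map eps_C cs)"

text \<open>
  The linear map \<open>gamma\<close> on the composition of \<open>D\<close> with itself is given by its values
  \<open>gamma d [d\<^sub>0, \<dots>, d\<^sub>n]\<close> for \<open>d \<in> D n\<close>, which are multilinear; its values at other arguments
  carry no information.
\<close>

locale graded_hopf_operad = connected_graded_coalgebra scale D Delta eps
  for scale :: "'k::field_char_0 \<Rightarrow> 'v::ab_group_add \<Rightarrow> 'v"
    and D :: "nat \<Rightarrow> 'v set"
    and Delta :: "'v \<Rightarrow> ('v list \<Rightarrow>\<^sub>0 'k)"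
    and eps :: "'v \<Rightarrow> 'k" +
  fixes gamma :: "'v \<Rightarrow> 'v list \<Rightarrow> 'v"
  assumes gamma_add_left: "\<lbrakk>d \<in> D n; d' \<in> D n; length ds = n + 1\<rbrakk> \<Longrightarrow>
        gamma (d + d') ds = gamma d ds + gamma d' ds"
    and gamma_scale_left: "\<lbrakk>d \<in> D n; length ds = n + 1\<rbrakk> \<Longrightarrow>
        gamma (scale c d) ds = scale c (gamma d ds)"
    and gamma_add: "\<lbrakk>d \<in> D n; length xs + length zs = n\<rbrakk> \<Longrightarrow>
        gamma d (xs @ (x + y) # zs) = gamma d (xs @ x # zs) + gamma d (xs @ y # zs)"
    and gamma_scale: "\<lbrakk>d \<in> D n; length xs + length zs = n\<rbrakk> \<Longrightarrow>
        gamma d (xs @ scale c x # zs) = scale c (gamma d (xs @ x # zs))"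
    and gamma_degree: "\<lbrakk>d \<in> D n; length ds = n + 1; length ms = n + 1;
          \<And>i. i \<le> n \<Longrightarrow> ds ! i \<in> D (ms ! i)\<rbrakk> \<Longrightarrow>
        gamma d ds \<in> D (n + sum_list ms)"
    and gamma_coproduct: "\<lbrakk>d \<in> D n; length ds = n + 1\<rbrakk> \<Longrightarrow>
        tensor_eq scale (Delta (gamma d ds))
          (lin_ext fscale (\<lambda>((a, as), (b, bs)). pure [gamma a as, gamma b bs])
             (comp_coproduct D Delta Delta d ds))"
    and gamma_counit: "\<lbrakk>d \<in> D n; length ds = n + 1\<rbrakk> \<Longrightarrow>
        eps (gamma d ds) = comp_counit eps eps d ds"
    and gamma_assoc: "\<lbrakk>d \<in> D n; length ds = n + 1; length ms = n + 1; length ess = n + 1;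
          \<And>i. i \<le> n \<Longrightarrow> ds ! i \<in> D (ms ! i);
          \<And>i. i \<le> n \<Longrightarrow> length (ess ! i) = ms ! i + 1\<rbrakk> \<Longrightarrow>
        gamma (gamma d ds) (concat ess) = gamma d (map2 gamma ds ess)"
    and gamma_unit_left: "d \<in> D n \<Longrightarrow> gamma (unit_elem D eps) [d] = d"
    and gamma_unit_right: "d \<in> D n \<Longrightarrow> gamma d (replicate (n + 1) (unit_elem D eps)) = d"

text \<open>For inhomogeneous \<open>b\<close>, the product is extended linearly from the homogeneous components.\<close>

definition operad_product ::
    "('k::field \<Rightarrow> 'v \<Rightarrow> 'v) \<Rightarrow> (nat \<Rightarrow> 'v set) \<Rightarrow> ('v \<Rightarrow> ('v list \<Rightarrow>\<^sub>0 'k)) \<Rightarrow>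
     ('v \<Rightarrow> 'v list \<Rightarrow> 'v) \<Rightarrow> 'v::ab_group_add \<Rightarrow> 'v \<Rightarrow> 'v" where
  "operad_product scale D Delta gamma a b =
     (\<Sum>n | component D n b \<noteq> 0.
        lin_ext scale (gamma (component D n b)) (iter_coproduct Delta n a))"

locale hopf_algebra = coalgebra scale Delta eps
  for scale :: "'k::field_char_0 \<Rightarrow> 'v::ab_group_add \<Rightarrow> 'v"
    and Delta :: "'v \<Rightarrow> ('v list \<Rightarrow>\<^sub>0 'k)"
    and eps :: "'v \<Rightarrow> 'k" +
  fixes mult :: "'v \<Rightarrow> 'v \<Rightarrow> 'v"
    and unit :: "'v"
  assumes mult_linear_left: "Vector_Spaces.linear scale scale (\<lambda>a. mult a b)"
    and mult_linear_right: "Vector_Spaces.linear scale scale (mult a)"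
    and mult_assoc: "mult (mult a b) c = mult a (mult b c)"
    and mult_unit_left: "mult unit a = a"
    and mult_unit_right: "mult a unit = a"
    and Delta_mult: "tensor_eq scale (Delta (mult a b))
        (lin_ext fscale (\<lambda>p.
           lin_ext fscale (\<lambda>q. pure [mult (p ! 0) (q ! 0), mult (p ! 1) (q ! 1)]) (Delta b))
         (Delta a))"
    and Delta_unit: "tensor_eq scale (Delta unit) (pure [unit, unit])"
    and eps_mult: "eps (mult a b) = eps a * eps b"
    and eps_unit: "eps unit = 1"
    and antipode: "\<exists>S. Vector_Spaces.linear scale scale S \<and>
        (\<forall>a. lin_ext scale (\<lambda>p. mult (S (p ! 0)) (p ! 1)) (Delta a) = scale (eps a) unit \<and>
             lin_ext scale (\<lambda>p. mult (p ! 0) (S (p ! 1))) (Delta a) = scale (eps a) unit)"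

end

theory Submission
  imports Defs
begin

text \<open>
  Write \<open>a\<^sub>0 \<otimes> \<dots> \<otimes> a\<^sub>n\<close> for the iterated coproduct of \<open>a\<close>, in Sweedler notation. For \<open>b\<close> of degree \<open>n\<close> the
  product is \<open>a \<cdot> b = \<gamma>(b; a\<^sub>0, \<dots>, a\<^sub>n)\<close>, and its main properties rest on one fact about iterated coproducts:
  by coassociativity, splitting \<open>a\<close> into \<open>n + 1\<close> factors and then the \<open>i\<close>-th factor into \<open>m\<^sub>i + 1\<close> factors is
  the same as splitting \<open>a\<close> at once into \<open>(m\<^sub>0 + 1) + \<dots> + (m\<^sub>n + 1)\<close> factors (\<open>iter_sweedler_nested\<close>).

  The coproduct is multiplicative (\<open>sweedler_mult\<close>): since \<open>\<gamma>\<close> is a coalgebra map, the coproduct of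
  \<open>\<gamma>(b; a\<^sub>0, \<dots>, a\<^sub>n)\<close> is a sum over \<open>i\<close> in which \<open>a\<^sub>i\<close> is split once more. The list then has \<open>n + 2\<close> entries and
  is an iterated coproduct of \<open>a\<close>, which regroups as the first \<open>i + 1\<close> entries from \<open>a'\<close> and the other
  \<open>n - i + 1\<close> from \<open>a''\<close>. So the sum over \<open>i\<close> is \<open>a' \<cdot> b' \<otimes> a'' \<cdot> b''\<close>.

  The product is associative (\<open>mult_assoc\<close>): for \<open>c\<close> of degree \<open>n\<close>, multiplicativity of the iterated coproduct
  gives \<open>(a \<cdot> b) \<cdot> c = \<gamma>(c; a\<^sub>0 \<cdot> b\<^sub>0, \<dots>, a\<^sub>n \<cdot> b\<^sub>n)\<close>. On the other side \<open>a \<cdot> (b \<cdot> c) = a \<cdot> \<gamma>(c; b\<^sub>0, \<dots>, b\<^sub>n)\<close>, and the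
  distributive law \<open>a \<cdot> \<gamma>(c; b\<^sub>0, \<dots>, b\<^sub>n) = \<gamma>(c; a\<^sub>0 \<cdot> b\<^sub>0, \<dots>, a\<^sub>n \<cdot> b\<^sub>n)\<close> (\<open>mult_gamma\<close>) is the associativity of
  \<open>\<gamma>\<close> combined with the splitting fact.

  The antipode exists because the coalgebra is connected: \<open>\<eta>\<epsilon> - id\<close> vanishes in degree \<open>0\<close>, hence its \<open>k\<close>-th
  convolution power vanishes in degrees below \<open>k\<close>, and the geometric series of these powers is a
  convolution inverse of \<open>id\<close>.

  Elements of tensor powers are only given by representatives, so all identities are tested against
  linear and multilinear forms with values in the field. These separate vectors (\<open>functional_eqI\<close>) and
  tensors (\<open>tensor_eqI\<close>), they do not depend on the representative (\<open>ev_tensor_cong\<close>), and they turn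
  every computation into an equality of scalars.
\<close>

section \<open>Linear extension and linear forms\<close>

abbreviation ev :: "('x \<Rightarrow> 'k) \<Rightarrow> ('x \<Rightarrow>\<^sub>0 'k::field) \<Rightarrow> 'k" where
  "ev \<equiv> lin_ext (*)"

lemma vector_space_mult: "vector_space ((*) :: 'k::field \<Rightarrow> 'k \<Rightarrow> 'k)"
  by unfold_locales (auto simp: algebra_simps)

lemma lin_ext_superset:
  assumes "vector_space s" "finite A" "Poly_Mapping.keys t \<subseteq> A"
  shows "lin_ext s f t = (\<Sum>x\<in>A. s (Poly_Mapping.lookup t x) (f x))"
proof -
  interpret vector_space s by fact
  show ?thesis unfolding lin_ext_def
    by (rule sum.mono_neutral_left) (use assms(2,3) in \<open>auto simp: in_keys_iff\<close>)
qed

lemma linear_lin_ext: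
  fixes f :: "'x \<Rightarrow> 'w::ab_group_add" and s :: "'k::field \<Rightarrow> 'w \<Rightarrow> 'w"
  assumes "vector_space s"
  shows "Vector_Spaces.linear fscale s (lin_ext s f)"
proof -
  interpret W: vector_space s by fact
  show ?thesis unfolding Vector_Spaces.linear_iff
  proof (intro conjI allI formal.vector_space_axioms assms)
    fix t u :: "'x \<Rightarrow>\<^sub>0 'k"
    let ?A = "Poly_Mapping.keys t \<union> Poly_Mapping.keys u"
    have "Poly_Mapping.keys (t + u) \<subseteq> ?A" by (rule Poly_Mapping.keys_add)
    then show "lin_ext s f (t + u) = lin_ext s f t + lin_ext s f u"
      by (simp add: lin_ext_superset[OF assms, of ?A] lookup_add W.scale_left_distrib sum.distrib)
  next
    fix c and t :: "'x \<Rightarrow>\<^sub>0 'k"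
    have "Poly_Mapping.keys (fscale c t) \<subseteq> Poly_Mapping.keys t"
      by (auto simp: in_keys_iff lookup_fscale)
    then show "lin_ext s f (fscale c t) = s c (lin_ext s f t)"
      by (simp add: lin_ext_superset[OF assms, of "Poly_Mapping.keys t"] lookup_fscale
            W.scale_sum_right)
  qed
qed

lemma ev_pure [simp]: "ev f (pure x) = f x"
  by (simp add: lin_ext_def)

lemma
  shows ev_add: "ev f (t + u) = ev f t + ev f u"
    and ev_diff: "ev f (t - u) = ev f t - ev f u"
    and ev_fscale: "ev f (fscale c t) = c * ev f t"
    and ev_sum_right: "ev f (\<Sum>i\<in>I. T i) = (\<Sum>i\<in>I. ev f (T i))"
proof -
  interpret Vector_Spaces.linear fscale "(*)" "ev f"
    by (rule linear_lin_ext[OF vector_space_mult])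
  show "ev f (t + u) = ev f t + ev f u" "ev f (t - u) = ev f t - ev f u"
    "ev f (fscale c t) = c * ev f t" "ev f (\<Sum>i\<in>I. T i) = (\<Sum>i\<in>I. ev f (T i))"
    by (auto simp: add diff scale sum)
qed

lemma ev_cong:
  "(\<And>x. x \<in> Poly_Mapping.keys t \<Longrightarrow> f x = g x) \<Longrightarrow> ev f t = ev g t"
  by (simp add: lin_ext_def)

text \<open>
  The scalar form of the rule that independent Sweedler sums may be exchanged.
\<close>

lemma ev_swap: "ev (\<lambda>x. ev (\<lambda>y. h x y) u) t = ev (\<lambda>y. ev (\<lambda>x. h x y) t) u"
  unfolding lin_ext_def by (simp add: sum_distrib_left) (subst sum.swap, simp add: mult.left_commute)

lemma ev_sum_left: "ev (\<lambda>x. \<Sum>i\<in>I. h i x) t = (\<Sum>i\<in>I. ev (h i) t)"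
  unfolding lin_ext_def by (simp add: sum_distrib_left) (rule sum.swap)

lemma ev_mult_left: "ev (\<lambda>x. c * f x) t = c * ev f t"
  by (simp add: lin_ext_def sum_distrib_left mult.left_commute)

lemma ev_mult_right: "ev (\<lambda>x. f x * c) t = ev f t * c"
  by (simp add: lin_ext_def sum_distrib_right mult.assoc)

lemma linear_comp_lin_ext:
  assumes "Vector_Spaces.linear s s' \<phi>"
  shows "\<phi> (lin_ext s f t) = lin_ext s' (\<lambda>x. \<phi> (f x)) t"
proof -
  interpret Vector_Spaces.linear s s' \<phi> by fact
  show ?thesis by (simp add: lin_ext_def sum scale)
qed

lemma ev_lin_ext: "ev f (lin_ext fscale g t) = ev (\<lambda>x. ev f (g x)) t"
  by (rule linear_comp_lin_ext[OF linear_lin_ext[OF vector_space_mult]])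

lemma ev_tprod: "ev f (tprod t u) = ev (\<lambda>xs. ev (\<lambda>ys. f (xs @ ys)) u) t"
  by (simp add: tprod_def ev_lin_ext)

lemma keys_lin_ext_subset:
  "Poly_Mapping.keys (lin_ext fscale g t) \<subseteq> (\<Union>x\<in>Poly_Mapping.keys t. Poly_Mapping.keys (g x))"
proof
  fix y assume "y \<in> Poly_Mapping.keys (lin_ext fscale g t)"
  then have "(\<Sum>x\<in>Poly_Mapping.keys t. Poly_Mapping.lookup t x * Poly_Mapping.lookup (g x) y) \<noteq> 0"
    by (simp add: in_keys_iff lin_ext_def lookup_sum lookup_fscale)
  then show "y \<in> (\<Union>x\<in>Poly_Mapping.keys t. Poly_Mapping.keys (g x))"
    by (auto simp: in_keys_iff elim!: sum.not_neutral_contains_not_neutral)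
qed

lemma tensors_lin_ext:
  "(\<And>x. x \<in> Poly_Mapping.keys t \<Longrightarrow> g x \<in> tensors n) \<Longrightarrow> lin_ext fscale g t \<in> tensors n"
  using keys_lin_ext_subset[of g t] unfolding tensors_def by blast

lemma tensors_pure: "length xs = n \<Longrightarrow> pure xs \<in> tensors n"
  by (simp add: tensors_def)

lemma tensors_tprod:
  "t \<in> tensors m \<Longrightarrow> u \<in> tensors n \<Longrightarrow> tprod t u \<in> tensors (m + n)"
  unfolding tprod_def by (intro tensors_lin_ext tensors_pure) (auto simp: tensors_def)

lemma tensors_add: "t \<in> tensors n \<Longrightarrow> u \<in> tensors n \<Longrightarrow> t + u \<in> tensors n"
  using Poly_Mapping.keys_add[of t u] unfolding tensors_def by auto

lemma tensors_fscale: "t \<in> tensors n \<Longrightarrow> fscale c t \<in> tensors n"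
  by (auto simp: tensors_def in_keys_iff lookup_fscale)

text \<open>
  Pure tensors form a basis of the space of formal combinations.
\<close>

lemma linear_eq_ev:
  assumes "Vector_Spaces.linear fscale (*) L"
  shows "L t = ev (\<lambda>x. L (pure x)) t"
proof -
  interpret Vector_Spaces.linear fscale "(*)" L by fact
  have "t = lin_ext fscale pure t"
  proof (rule poly_mapping_eqI)
    fix y
    have "(\<Sum>x\<in>Poly_Mapping.keys t. Poly_Mapping.lookup t x * (1 when x = y)) = Poly_Mapping.lookup t y"
      by (subst sum.mono_neutral_right[of _ "Poly_Mapping.keys t \<inter> {y}"])
        (auto simp: when_def in_keys_iff Int_insert_right split: if_splits)
    then show "Poly_Mapping.lookup t y = Poly_Mapping.lookup (lin_ext fscale pure t) y"
      by (simp add: lin_ext_def lookup_sum lookup_fscale lookup_single)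
  qed
  then have "L t = L (lin_ext fscale pure t)" by simp
  also have "\<dots> = ev (\<lambda>x. L (pure x)) t"
    by (rule linear_comp_lin_ext[OF assms])
  finally show ?thesis .
qed

abbreviation functional :: "('k::field \<Rightarrow> 'v::ab_group_add \<Rightarrow> 'v) \<Rightarrow> ('v \<Rightarrow> 'k) \<Rightarrow> bool" where
  "functional s \<equiv> Vector_Spaces.linear s (*)"

lemma functionalI:
  fixes s :: "'k::field \<Rightarrow> 'v::ab_group_add \<Rightarrow> 'v"
  assumes "vector_space s"
    and "\<And>x y. \<phi> (x + y) = \<phi> x + \<phi> y" "\<And>c x. \<phi> (s c x) = c * \<phi> x"
  shows "functional s \<phi>"
  using assms vector_space_mult by (auto simp: Vector_Spaces.linear_iff)

lemma
  assumes "functional s \<phi>"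
  shows functional_add: "\<phi> (x + y) = \<phi> x + \<phi> y"
    and functional_scale: "\<phi> (s c x) = c * \<phi> x"
    and functional_zero: "\<phi> 0 = 0"
    and functional_diff: "\<phi> (x - y) = \<phi> x - \<phi> y"
    and functional_sum: "\<phi> (\<Sum>i\<in>I. h i) = (\<Sum>i\<in>I. \<phi> (h i))"
proof -
  interpret Vector_Spaces.linear s "(*)" \<phi> by fact
  show "\<phi> (x + y) = \<phi> x + \<phi> y" "\<phi> (s c x) = c * \<phi> x" "\<phi> 0 = 0" "\<phi> (x - y) = \<phi> x - \<phi> y"
    "\<phi> (\<Sum>i\<in>I. h i) = (\<Sum>i\<in>I. \<phi> (h i))"
    by (auto simp: add scale zero diff sum)
qed

text \<open>
  A basis of \<open>span S\<close> stays independent when \<open>x\<close> is added to it, so the values \<open>0\<close> on the basis and \<open>1\<close> at \<open>x\<close>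
  extend to a linear form.
\<close>

lemma (in vector_space) separating_functional:
  assumes "x \<notin> span S"
  obtains \<phi> where "functional scale \<phi>" "\<And>y. y \<in> S \<Longrightarrow> \<phi> y = 0" "\<phi> x = 1"
proof -
  interpret vector_space_pair scale "(*) :: 'a \<Rightarrow> 'a \<Rightarrow> 'a"
    by (intro vector_space_pair.intro vector_space_mult vector_space_axioms)
  obtain B where B: "B \<subseteq> S" "independent B" "S \<subseteq> span B"
    using maximal_independent_subset by blast
  have "x \<notin> span B" using assms span_mono[OF B(1)] by blast
  then have ind: "independent (insert x B)" using B(2) by (simp add: independent_insert)
  obtain \<phi> where \<phi>: "functional scale \<phi>" "\<forall>y\<in>insert x B. \<phi> y = (if y = x then 1 else 0)"
    using linear_independent_extend[OF ind, of "\<lambda>y. if y = x then 1 else 0"] by blast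
  interpret f: Vector_Spaces.linear scale "(*)" \<phi> by fact
  have "x \<notin> B" using \<open>x \<notin> span B\<close> span_base by blast
  then have "\<phi> y = 0" if "y \<in> B" for y using \<phi>(2) that by auto
  then have "\<phi> y = 0" if "y \<in> span B" for y
    using f.eq_0_on_span that by blast
  with \<phi> B(3) show thesis by (intro that[of \<phi>]) auto
qed

lemma functional_eqI:
  assumes "vector_space s"
    and "\<And>\<phi>. functional s \<phi> \<Longrightarrow> \<phi> x = \<phi> y"
  shows "x = y"
proof (rule ccontr)
  interpret vector_space s by fact
  assume "x \<noteq> y"
  then have "x - y \<notin> span {}" by simp
  then obtain \<phi> where "functional s \<phi>" "\<phi> (x - y) = 1"
    by (rule separating_functional)
  with assms(2)[of \<phi>] show False by (simp add: functional_diff)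
qed

lemma functional_comp_linear:
  "Vector_Spaces.linear s s g \<Longrightarrow> functional s \<phi> \<Longrightarrow> functional s (\<lambda>x. \<phi> (g x))"
  using Vector_Spaces.linear_compose[of s s g "(*)" \<phi>] by (simp add: o_def)

lemma linearI_functional:
  assumes "vector_space s"
    and "\<And>\<phi>. functional s \<phi> \<Longrightarrow> functional s (\<lambda>x. \<phi> (g x))"
  shows "Vector_Spaces.linear s s g"
  unfolding Vector_Spaces.linear_iff
proof (intro conjI allI assms(1); rule functional_eqI[OF assms(1)])
    fix \<phi> x y assume "functional s \<phi>"
    then show "\<phi> (g (x + y)) = \<phi> (g x + g y)"
      using functional_add[OF assms(2)] by (simp add: functional_add)
  next
    fix \<phi> c x assume "functional s \<phi>"
    then show "\<phi> (g (s c x)) = \<phi> (s c (g x))"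
      using functional_scale[OF assms(2)] by (simp add: functional_scale)
qed

section \<open>Multilinear forms on tensor powers\<close>

definition multilinear ::
    "('k::field \<Rightarrow> 'v::ab_group_add \<Rightarrow> 'v) \<Rightarrow> nat \<Rightarrow> ('v list \<Rightarrow> 'k) \<Rightarrow> bool" where
  "multilinear s n f \<longleftrightarrow>
     (\<forall>xs zs. length xs + length zs + 1 = n \<longrightarrow> functional s (\<lambda>x. f (xs @ x # zs)))"

text \<open>
  The relations involve lists of every length, while \<open>f\<close> is multilinear only on lists of length \<open>n\<close>.
  Replacing \<open>f\<close> by zero on all other lists gives a form that vanishes on all of the relations.
\<close>

lemma ev_tensor_cong:
  assumes "vector_space s"
    and "tensor_eq s t u" "t \<in> tensors n" "u \<in> tensors n" "multilinear s n f"
  shows "ev f t = ev f u"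
proof -
  define f' where "f' xs = (if length xs = n then f xs else 0)" for xs
  have slot: "functional s (\<lambda>x. f' (xs @ x # zs))" for xs zs
  proof (cases "length xs + length zs + 1 = n")
    case True
    with assms(5) show ?thesis by (simp add: f'_def multilinear_def)
  next
    case False
    then have "(\<lambda>x. f' (xs @ x # zs)) = (\<lambda>x. 0)" by (auto simp: f'_def)
    then show ?thesis by (auto intro: functionalI[OF assms(1)])
  qed
  interpret Vector_Spaces.linear fscale "(*)" "ev f'"
    by (rule linear_lin_ext[OF vector_space_mult])
  have "ev f' r = 0" if "r \<in> multilinearity_relations s" for r
    using that functional_add[OF slot] functional_scale[OF slot]
    by (auto simp: multilinearity_relations_def ev_diff ev_fscale)
  moreover have "t - u \<in> formal.span (multilinearity_relations s)"
    using assms(2) by (simp add: tensor_eq_def)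
  ultimately have "ev f' (t - u) = 0"
    by (metis eq_0_on_span)
  moreover have "ev f v = ev f' v" if "v \<in> tensors n" for v
    using that by (intro ev_cong) (auto simp: tensors_def f'_def)
  ultimately show ?thesis using assms(3,4) by (simp add: ev_diff)
qed

text \<open>
  If \<open>t - u\<close> is outside the span of the relations, a linear form that separates it from the span
  is multilinear when restricted to pure tensors, and so takes different values at \<open>t\<close> and \<open>u\<close>.
\<close>

lemma tensor_eqI:
  assumes "vector_space s"
    and "\<And>f. multilinear s n f \<Longrightarrow> ev f t = ev f u"
  shows "tensor_eq s t u"
proof (rule ccontr)
  assume "\<not> tensor_eq s t u"
  then have "t - u \<notin> formal.span (multilinearity_relations s)"
    by (simp add: tensor_eq_def)
  then obtain L where L: "functional fscale L"
      and rel: "\<And>r. r \<in> multilinearity_relations s \<Longrightarrow> L r = 0" and L1: "L (t - u) = 1"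
    using formal.separating_functional by metis
  define f where "f xs = L (pure xs)" for xs
  interpret Vector_Spaces.linear fscale "(*)" L by fact
  have "functional s (\<lambda>x. f (xs @ x # zs))" for xs zs
  proof (rule functionalI[OF assms(1)])
    fix x y
    have "L (pure (xs @ (x + y) # zs) - pure (xs @ x # zs) - pure (xs @ y # zs)) = 0"
      by (rule rel) (auto simp: multilinearity_relations_def)
    then show "f (xs @ (x + y) # zs) = f (xs @ x # zs) + f (xs @ y # zs)"
      by (simp add: f_def diff add algebra_simps)
  next
    fix c x
    have "L (pure (xs @ s c x # zs) - fscale c (pure (xs @ x # zs))) = 0"
      by (rule rel) (unfold multilinearity_relations_def, blast)
    then show "f (xs @ s c x # zs) = c * f (xs @ x # zs)"
      by (simp add: f_def diff scale)
  qed
  then have "ev f t = ev f u" by (intro assms(2)) (simp add: multilinear_def)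
  then have "L t = L u" unfolding f_def by (simp add: linear_eq_ev[OF L, symmetric])
  with L1 show False by (simp add: diff)
qed

lemma multilinear_slot:
  "multilinear s n f \<Longrightarrow> length xs + length zs + 1 = n \<Longrightarrow> functional s (\<lambda>x. f (xs @ x # zs))"
  by (simp add: multilinear_def)

lemma multilinearI:
  "(\<And>xs zs. length xs + length zs + 1 = n \<Longrightarrow> functional s (\<lambda>x. f (xs @ x # zs))) \<Longrightarrow>
     multilinear s n f"
  by (simp add: multilinear_def)

lemma multilinear_prefix:
  "multilinear s (m + n) f \<Longrightarrow> length xs = m \<Longrightarrow> multilinear s n (\<lambda>ys. f (xs @ ys))"
  by (rule multilinearI) (use multilinear_slot[of s "m + n" f "xs @ _"] in auto)

lemma multilinear_suffix:
  "multilinear s (m + n) f \<Longrightarrow> length ys = n \<Longrightarrow> multilinear s m (\<lambda>xs. f (xs @ ys))"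
  by (rule multilinearI) (use multilinear_slot[of s "m + n" f _ "_ @ ys"] in auto)

lemma multilinear_Cons:
  "multilinear s (Suc n) f \<Longrightarrow> multilinear s n (\<lambda>xs. f (x # xs))"
  using multilinear_prefix[of s 1 n f "[x]"] by simp

lemma multilinear_hd:
  "multilinear s (Suc n) f \<Longrightarrow> length xs = n \<Longrightarrow> functional s (\<lambda>x. f (x # xs))"
  using multilinear_slot[of s "Suc n" f "[]" xs] by simp

lemma multilinear_snoc:
  "multilinear s (Suc n) f \<Longrightarrow> multilinear s n (\<lambda>xs. f (xs @ [x]))"
  using multilinear_suffix[of s n 1 f "[x]"] by simp

lemma multilinear_last:
  "multilinear s (Suc n) f \<Longrightarrow> length xs = n \<Longrightarrow> functional s (\<lambda>x. f (xs @ [x]))"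
  using multilinear_slot[of s "Suc n" f xs "[]"] by simp

lemma multilinear_map2:
  assumes F: "multilinear s n F" and len: "length cs = n"
    and h: "\<And>c \<phi>. functional s \<phi> \<Longrightarrow> functional s (\<lambda>x. \<phi> (h c x))"
  shows "multilinear s n (\<lambda>xs. F (map2 h cs xs))"
proof (rule multilinearI)
  fix xs zs :: "'b list"
  assume l: "length xs + length zs + 1 = n"
  define k where "k = length xs"
  have cs: "cs = take k cs @ cs ! k # drop (Suc k) cs"
    using l len by (intro id_take_nth_drop) (simp add: k_def)
  have "functional s (\<lambda>x. F (map2 h (take k cs) xs @ h (cs ! k) x # map2 h (drop (Suc k) cs) zs))"
    by (intro h multilinear_slot[OF F]) (use l len in \<open>simp add: k_def\<close>)
  moreover have "map2 h (take k cs) xs @ h (cs ! k) x # map2 h (drop (Suc k) cs) zs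
      = map2 h cs (xs @ x # zs)" for x
    using l len by (subst (4) cs) (simp add: k_def zip_append)
  ultimately show "functional s (\<lambda>x. F (map2 h cs (xs @ x # zs)))" by simp
qed

lemma multilinear_take_drop:
  fixes G :: "'v::ab_group_add list \<Rightarrow> 'v list \<Rightarrow> 'k::field"
  assumes "\<And>ys. length ys = l \<Longrightarrow> multilinear s k (\<lambda>xs. G xs ys)"
    and "\<And>xs. length xs = k \<Longrightarrow> multilinear s l (G xs)"
  shows "multilinear s (k + l) (\<lambda>zs. G (take k zs) (drop k zs))"
proof (rule multilinearI)
  fix xs zs :: "'v list" assume len: "length xs + length zs + 1 = k + l"
  show "functional s (\<lambda>x. G (take k (xs @ x # zs)) (drop k (xs @ x # zs)))"
  proof (cases "length xs < k")
    case True
    define j where "j = k - Suc (length xs)"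
    have k: "k = length xs + Suc j" using True by (simp add: j_def)
    show ?thesis
      using multilinear_slot[OF assms(1), of "drop j zs" xs "take j zs"] len by (simp add: k)
  next
    case False
    then show ?thesis
      using multilinear_slot[OF assms(2), of "take k xs" "drop k xs" zs] len by simp
  qed
qed

section \<open>Sweedler sums\<close>

context coalgebra
begin

abbreviation bilinear :: "('v \<Rightarrow> 'v \<Rightarrow> 'k) \<Rightarrow> bool" where
  "bilinear \<beta> \<equiv> (\<forall>v. functional scale (\<lambda>u. \<beta> u v)) \<and> (\<forall>u. functional scale (\<beta> u))"

lemmas scale_functionalI = functionalI[OF vector_space_axioms]

lemma functional_times_left: "functional scale \<phi> \<Longrightarrow> functional scale (\<lambda>x. c * \<phi> x)"
  by (rule scale_functionalI) (simp_all add: functional_add functional_scale algebra_simps)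

lemma functional_times_right: "functional scale \<phi> \<Longrightarrow> functional scale (\<lambda>x. \<phi> x * c)"
  by (rule scale_functionalI) (simp_all add: functional_add functional_scale algebra_simps)

lemma functional_sum_param:
  "(\<And>i. i \<in> I \<Longrightarrow> functional scale (h i)) \<Longrightarrow> functional scale (\<lambda>x. \<Sum>i\<in>I. h i x)"
  by (rule scale_functionalI)
    (auto simp: functional_add[of scale] functional_scale[of scale] sum_distrib_left simp flip: sum.distrib
      intro!: sum.cong)

lemma functional_ev_param:
  assumes "\<And>y. y \<in> Poly_Mapping.keys t \<Longrightarrow> functional scale (\<lambda>x. f x y)"
  shows "functional scale (\<lambda>x. ev (f x) t)"
  unfolding lin_ext_def
  by (intro functional_sum_param functional_times_left assms)

lemma functional_eps: "functional scale eps"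
  by (rule eps_linear)

lemma multilinear_2:
  assumes "bilinear \<beta>" shows "multilinear scale 2 (\<lambda>p. \<beta> (p ! 0) (p ! 1))"
proof (rule multilinearI)
  fix xs zs :: "'v list" assume "length xs + length zs + 1 = 2"
  then consider z where "xs = []" "zs = [z]" | x where "xs = [x]" "zs = []"
    by (cases xs; cases zs) auto
  then show "functional scale (\<lambda>x. \<beta> ((xs @ x # zs) ! 0) ((xs @ x # zs) ! 1))"
    using assms by cases simp_all
qed

lemma multilinear_3:
  assumes "\<And>v w. functional scale (\<lambda>u. T u v w)" "\<And>u w. functional scale (\<lambda>v. T u v w)"
    "\<And>u v. functional scale (T u v)"
  shows "multilinear scale 3 (\<lambda>p. T (p ! 0) (p ! 1) (p ! 2))"
proof (rule multilinearI)
  fix xs zs :: "'v list" assume "length xs + length zs + 1 = 3"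
  then consider y z where "xs = []" "zs = [y, z]" | x z where "xs = [x]" "zs = [z]"
    | x y where "xs = [x, y]" "zs = []"
    by (cases xs rule: list.exhaust[case_product list.exhaust[of "tl xs"]];
        cases zs rule: list.exhaust[case_product list.exhaust[of "tl zs"]]) auto
  then show "functional scale
      (\<lambda>x. T ((xs @ x # zs) ! 0) ((xs @ x # zs) ! 1) ((xs @ x # zs) ! 2))"
    using assms by cases (simp_all add: numeral_2_eq_2)
qed

text \<open>
  \<open>sweedler x \<beta>\<close> is the Sweedler sum of \<open>\<beta>(x', x'')\<close> over \<open>\<Delta>(x)\<close>, and \<open>iter_sweedler n x F\<close> is the sum of
  \<open>F [x\<^sub>0, \<dots>, x\<^sub>n]\<close> over the iterated coproduct of \<open>x\<close>.
\<close>

definition sweedler :: "'v \<Rightarrow> ('v \<Rightarrow> 'v \<Rightarrow> 'k) \<Rightarrow> 'k" where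
  "sweedler x \<beta> = ev (\<lambda>p. \<beta> (p ! 0) (p ! 1)) (Delta x)"

definition iter_sweedler :: "nat \<Rightarrow> 'v \<Rightarrow> ('v list \<Rightarrow> 'k) \<Rightarrow> 'k" where
  "iter_sweedler n x F = ev F (iter_coproduct Delta n x)"

lemma keys_Delta: "p \<in> Poly_Mapping.keys (Delta x) \<Longrightarrow> p = [p ! 0, p ! 1]"
  using Delta_tensor[of x]
  by (cases p rule: list.exhaust[case_product list.exhaust[of "tl p"]]) (auto simp: tensors_def)

lemma iter_coproduct_tensors: "iter_coproduct Delta n x \<in> tensors (Suc n)"
proof (induction n arbitrary: x)
  case 0 show ?case by (simp add: tensors_pure)
next
  case (Suc n)
  have "tprod (iter_coproduct Delta n y) (pure [z]) \<in> tensors (Suc n + 1)" for y z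
    by (intro tensors_tprod Suc.IH tensors_pure) simp
  then show ?case by (simp add: tensors_lin_ext)
qed

lemma iter_sweedler_0: "iter_sweedler 0 x F = F [x]"
  by (simp add: iter_sweedler_def)

lemma iter_sweedler_Suc:
  "iter_sweedler (Suc n) x F = sweedler x (\<lambda>u v. iter_sweedler n u (\<lambda>xs. F (xs @ [v])))"
  by (simp add: iter_sweedler_def sweedler_def ev_lin_ext ev_tprod)

lemma iter_sweedler_cong:
  "(\<And>xs. length xs = Suc n \<Longrightarrow> F xs = G xs) \<Longrightarrow> iter_sweedler n x F = iter_sweedler n x G"
  unfolding iter_sweedler_def using iter_coproduct_tensors[of n x]
  by (intro ev_cong) (auto simp: tensors_def)

lemma sweedler_swap:
  "sweedler x (\<lambda>u v. sweedler y (\<lambda>p q. h u v p q)) = sweedler y (\<lambda>p q. sweedler x (\<lambda>u v. h u v p q))"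
  unfolding sweedler_def by (rule ev_swap)

lemma sweedler_iter_swap:
  "sweedler x (\<lambda>u v. iter_sweedler n y (\<lambda>ys. h u v ys)) =
     iter_sweedler n y (\<lambda>ys. sweedler x (\<lambda>u v. h u v ys))"
  unfolding sweedler_def iter_sweedler_def by (rule ev_swap)

lemma iter_sweedler_swap:
  "iter_sweedler m x (\<lambda>xs. iter_sweedler n y (\<lambda>ys. h xs ys)) =
     iter_sweedler n y (\<lambda>ys. iter_sweedler m x (\<lambda>xs. h xs ys))"
  unfolding iter_sweedler_def by (rule ev_swap)

lemma functional_sweedler_param:
  "(\<And>u v. functional scale (\<lambda>x. h x u v)) \<Longrightarrow> functional scale (\<lambda>x. sweedler y (h x))"
  unfolding sweedler_def by (rule functional_ev_param)

lemma functional_iter_sweedler_param: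
  assumes "\<And>ys. length ys = Suc n \<Longrightarrow> functional scale (\<lambda>x. h x ys)"
  shows "functional scale (\<lambda>x. iter_sweedler n y (h x))"
  unfolding iter_sweedler_def
  by (rule functional_ev_param) (use assms iter_coproduct_tensors[of n y] in \<open>auto simp: tensors_def\<close>)

lemma functional_sweedler:
  assumes "bilinear \<beta>"
  shows "functional scale (\<lambda>x. sweedler x \<beta>)"
proof -
  note cong = ev_tensor_cong[OF vector_space_axioms _ _ _ multilinear_2[OF assms]]
  show ?thesis unfolding sweedler_def
    by (rule scale_functionalI)
      (simp_all add: cong[OF Delta_add] cong[OF Delta_scale] Delta_tensor tensors_add tensors_fscale
        ev_add ev_fscale del: One_nat_def)
qed

lemma functional_iter_sweedler:
  "multilinear scale (Suc n) F \<Longrightarrow> functional scale (\<lambda>x. iter_sweedler n x F)"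
proof (induction n arbitrary: F)
  case 0
  then show ?case using multilinear_hd[of scale 0 F "[]"] by (simp add: iter_sweedler_0)
next
  case (Suc n)
  show ?case unfolding iter_sweedler_Suc
    by (intro functional_sweedler conjI allI Suc.IH multilinear_snoc[OF Suc.prems]
        functional_iter_sweedler_param multilinear_last[OF Suc.prems])
qed

lemma sweedler_coassoc:
  assumes "\<And>v w. functional scale (\<lambda>u. T u v w)" "\<And>u w. functional scale (\<lambda>v. T u v w)"
    "\<And>u v. functional scale (T u v)"
  shows "sweedler x (\<lambda>u w. sweedler u (\<lambda>p q. T p q w)) =
     sweedler x (\<lambda>u w. sweedler w (\<lambda>p q. T u p q))"
proof -
  let ?L = "lin_ext fscale (\<lambda>p. tprod (Delta (p ! 0)) (pure [p ! 1])) (Delta x)"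
  let ?R = "lin_ext fscale (\<lambda>p. tprod (pure [p ! 0]) (Delta (p ! 1))) (Delta x)"
  let ?f = "\<lambda>p. T (p ! 0) (p ! 1) (p ! 2)"
  have "?L \<in> tensors (2 + 1)" "?R \<in> tensors (1 + 2)"
    by (intro tensors_lin_ext tensors_tprod Delta_tensor tensors_pure; simp)+
  then have "?L \<in> tensors 3" "?R \<in> tensors 3"
    by (simp_all only: numeral_Bit0 numeral_Bit1 numeral_One add.assoc)
  then have "ev ?f ?L = ev ?f ?R"
    using multilinear_3[OF assms] coassoc[of x]
    by (intro ev_tensor_cong[OF vector_space_axioms, of _ _ 3])
  moreover have "ev ?f ?L = sweedler x (\<lambda>u w. sweedler u (\<lambda>p q. T p q w))"
    unfolding sweedler_def ev_lin_ext ev_tprod ev_pure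
    by (intro ev_cong) (use Delta_tensor in \<open>auto simp: tensors_def nth_append\<close>)
  moreover have "ev ?f ?R = sweedler x (\<lambda>u w. sweedler w (\<lambda>p q. T u p q))"
    unfolding sweedler_def ev_lin_ext ev_tprod ev_pure
    by (intro ev_cong) (auto simp: numeral_2_eq_2)
  ultimately show ?thesis by simp
qed

lemma sweedler_counit_left: "functional scale \<phi> \<Longrightarrow> sweedler x (\<lambda>u v. eps u * \<phi> v) = \<phi> x"
  using linear_comp_lin_ext[of scale "(*)" \<phi> "\<lambda>p. scale (eps (p ! 0)) (p ! 1)" "Delta x"]
  by (simp add: counit_left sweedler_def functional_scale del: One_nat_def)

lemma sweedler_counit_right: "functional scale \<phi> \<Longrightarrow> sweedler x (\<lambda>u v. \<phi> u * eps v) = \<phi> x"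
  using linear_comp_lin_ext[of scale "(*)" \<phi> "\<lambda>p. scale (eps (p ! 1)) (p ! 0)" "Delta x"]
  by (simp add: counit_right sweedler_def functional_scale mult.commute del: One_nat_def)

lemma multilinear_iter_sweedler_param:
  "(\<And>ys. length ys = Suc n \<Longrightarrow> multilinear scale k (\<lambda>xs. h xs ys)) \<Longrightarrow>
     multilinear scale k (\<lambda>xs. iter_sweedler n y (h xs))"
  by (simp add: multilinear_def functional_iter_sweedler_param)

lemma bilinear_iter_sweedler_snoc:
  "multilinear scale (Suc (Suc n)) F \<Longrightarrow> bilinear (\<lambda>u v. iter_sweedler n u (\<lambda>xs. F (xs @ [v])))"
  by (intro conjI allI functional_iter_sweedler functional_iter_sweedler_param
      multilinear_snoc multilinear_last)

lemma iter_sweedler_eps: "iter_sweedler n x (\<lambda>xs. prod_list (map eps xs)) = eps x"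
proof (induction n arbitrary: x)
  case (Suc n)
  have "iter_sweedler n u (\<lambda>xs. prod_list (map eps xs) * c) = eps u * c" for u c
    using Suc.IH[of u] by (simp add: iter_sweedler_def ev_mult_right)
  then show ?case by (simp add: iter_sweedler_Suc sweedler_counit_left functional_eps)
qed (simp add: iter_sweedler_0)

text \<open>
  The iterated coproduct can be built by splitting \<open>x\<close> once and iterating in both halves. The iterated
  coproduct itself always splits the first factor again; coassociativity moves the last splitting to
  the second half.
\<close>

lemma iter_sweedler_split:
  "multilinear scale (Suc (Suc (m + n))) F \<Longrightarrow>
     iter_sweedler (Suc (m + n)) x F =
       sweedler x (\<lambda>u v. iter_sweedler m u (\<lambda>xs. iter_sweedler n v (\<lambda>ys. F (xs @ ys))))"
proof (induction n arbitrary: x F)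
  case 0
  show ?case by (simp add: iter_sweedler_Suc iter_sweedler_0)
next
  case (Suc n)
  define T where "T p q w =
      iter_sweedler m p (\<lambda>xs. iter_sweedler n q (\<lambda>ys. F (xs @ ys @ [w])))" for p q w
  have F: "multilinear scale (Suc m + (Suc n + 1)) F" using Suc.prems by simp
  have T1: "functional scale (\<lambda>p. T p q w)" for q w
    unfolding T_def
    by (intro functional_iter_sweedler multilinear_iter_sweedler_param multilinear_suffix[OF F]) simp
  have T2: "functional scale (\<lambda>q. T p q w)" for p w
    unfolding T_def
    by (intro functional_iter_sweedler functional_iter_sweedler_param
        multilinear_suffix[OF multilinear_prefix[OF F], simplified]) simp_all
  have T3: "functional scale (T p q)" for p q
    unfolding T_def
    by (intro functional_iter_sweedler_param)
      (use multilinear_last[of scale "Suc m + Suc n" F] F in \<open>simp flip: append_assoc\<close>)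
  have "iter_sweedler (Suc (m + Suc n)) x F = sweedler x (\<lambda>u w. sweedler u (\<lambda>p q. T p q w))"
    using Suc.IH[OF multilinear_snoc[of scale "Suc (Suc (m + n))" F]] Suc.prems
    by (simp add: iter_sweedler_Suc[of "Suc (m + n)"] T_def)
  also have "\<dots> = sweedler x (\<lambda>u w. sweedler w (\<lambda>p q. T u p q))"
    by (intro sweedler_coassoc T1 T2 T3)
  also have "\<dots> = sweedler x (\<lambda>u v. iter_sweedler m u (\<lambda>xs. iter_sweedler (Suc n) v (\<lambda>ys. F (xs @ ys))))"
    by (simp add: T_def sweedler_iter_swap iter_sweedler_Suc[of n])
  finally show ?case .
qed

text \<open>
  Given vectors \<open>a\<^sub>0, a\<^sub>1, \<dots>\<close> and numbers \<open>m\<^sub>0, m\<^sub>1, \<dots>\<close>, the sum of \<open>F\<close> over the concatenations of the iterated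
  coproducts of the \<open>a\<^sub>i\<close> into \<open>m\<^sub>i + 1\<close> factors.
\<close>

primrec nested_sweedler :: "nat list \<Rightarrow> 'v list \<Rightarrow> ('v list \<Rightarrow> 'k) \<Rightarrow> 'k" where
  "nested_sweedler [] as F = F []"
| "nested_sweedler (m # ms) as F =
     iter_sweedler m (hd as) (\<lambda>xs. nested_sweedler ms (tl as) (\<lambda>ys. F (xs @ ys)))"

lemma functional_nested_sweedler_param:
  "(\<And>ys. length ys = length ms + sum_list ms \<Longrightarrow> functional scale (\<lambda>x. h x ys)) \<Longrightarrow>
     functional scale (\<lambda>x. nested_sweedler ms as (h x))"
proof (induction ms arbitrary: as h)
  case (Cons m ms)
  show ?case unfolding nested_sweedler.simps
    by (intro functional_iter_sweedler_param Cons.IH Cons.prems) simp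
qed simp

lemma multilinear_nested_sweedler_param:
  "(\<And>ys. length ys = length ms + sum_list ms \<Longrightarrow> multilinear scale k (\<lambda>xs. h xs ys)) \<Longrightarrow>
     multilinear scale k (\<lambda>xs. nested_sweedler ms as (h xs))"
  by (simp add: multilinear_def functional_nested_sweedler_param)

lemma multilinear_nested_sweedler:
  "multilinear scale (length ms + sum_list ms) F \<Longrightarrow>
     multilinear scale (length ms) (\<lambda>as. nested_sweedler ms as F)"
proof (induction ms arbitrary: F)
  case Nil
  show ?case by (simp add: multilinear_def)
next
  case (Cons m ms)
  have F: "multilinear scale (Suc m + (length ms + sum_list ms)) F"
    using Cons.prems by (simp add: algebra_simps)
  show ?case
  proof (rule multilinearI)
    fix xs zs :: "'v list" assume len: "length xs + length zs + 1 = length (m # ms)"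
    show "functional scale (\<lambda>x. nested_sweedler (m # ms) (xs @ x # zs) F)"
    proof (cases xs)
      case Nil
      then show ?thesis
        by (auto intro!: functional_iter_sweedler multilinear_nested_sweedler_param
            multilinear_suffix[OF F])
    next
      case xs: (Cons x' xs')
      then show ?thesis
        using len
        by (auto intro!: functional_iter_sweedler_param multilinear_slot[OF Cons.IH]
            multilinear_prefix[OF F])
    qed
  qed
qed

text \<open>
  Splitting \<open>x\<close> and then each of its factors is a single iterated coproduct. In the induction on the
  number of factors, \<open>iter_sweedler_split\<close> separates the first factor from the others.
\<close>

lemma iter_sweedler_nested:
  "length ms = Suc n \<Longrightarrow> multilinear scale (Suc n + sum_list ms) F \<Longrightarrow>
     iter_sweedler (n + sum_list ms) x F = iter_sweedler n x (\<lambda>as. nested_sweedler ms as F)"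
proof (induction ms arbitrary: n x F)
  case (Cons m ms)
  show ?case
  proof (cases n)
    case 0
    with Cons.prems show ?thesis by (simp add: iter_sweedler_0)
  next
    case (Suc k)
    have len: "length ms = Suc k" using Cons.prems Suc by simp
    have F: "multilinear scale (Suc m + (Suc k + sum_list ms)) F"
      using Cons.prems Suc by (simp add: algebra_simps)
    have nested: "multilinear scale (Suc (Suc k)) (\<lambda>as. nested_sweedler (m # ms) as F)"
      using multilinear_nested_sweedler[of "m # ms" F] F len by (simp add: algebra_simps)
    have "iter_sweedler n x (\<lambda>as. nested_sweedler (m # ms) as F) =
        sweedler x (\<lambda>u v. iter_sweedler k v (\<lambda>as. iter_sweedler m u
          (\<lambda>xs. nested_sweedler ms as (\<lambda>ys. F (xs @ ys)))))"
      using iter_sweedler_split[of 0 k, simplified, OF nested]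
      by (simp add: Suc iter_sweedler_0)
    also have "\<dots> = sweedler x (\<lambda>u v. iter_sweedler m u (\<lambda>xs. iter_sweedler k v
          (\<lambda>as. nested_sweedler ms as (\<lambda>ys. F (xs @ ys)))))"
      by (simp add: iter_sweedler_swap[of k])
    also have "\<dots> = sweedler x (\<lambda>u v. iter_sweedler m u (\<lambda>xs. iter_sweedler (k + sum_list ms) v
          (\<lambda>ys. F (xs @ ys))))"
    proof -
      have "iter_sweedler k v (\<lambda>as. nested_sweedler ms as (\<lambda>ys. F (xs @ ys))) =
          iter_sweedler (k + sum_list ms) v (\<lambda>ys. F (xs @ ys))" if "length xs = Suc m" for xs v
        by (rule Cons.IH[symmetric, OF len multilinear_prefix[OF F that]])
      then show ?thesis
        by (intro arg_cong[where f = "sweedler x"] ext iter_sweedler_cong)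
    qed
    also have "\<dots> = iter_sweedler (n + sum_list (m # ms)) x F"
      using iter_sweedler_split[of m "k + sum_list ms" F x] F by (simp add: Suc algebra_simps)
    finally show ?thesis by simp
  qed
qed simp

lemma nested_sweedler_replicate_0:
  "length xs = i \<Longrightarrow> nested_sweedler (replicate i 0 @ ms) (xs @ ys) F =
     nested_sweedler ms ys (\<lambda>zs. F (xs @ zs))"
proof (induction i arbitrary: xs F)
  case (Suc i)
  then show ?case by (cases xs) (auto simp: iter_sweedler_0)
qed simp

text \<open>
  The case of \<open>iter_sweedler_nested\<close> in which only the \<open>i\<close>-th factor is split, into two parts.
\<close>

lemma iter_sweedler_insert:
  assumes "i \<le> n" "multilinear scale (Suc (Suc n)) F"
  shows "iter_sweedler n x (\<lambda>as. sweedler (as ! i)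
      (\<lambda>u v. F (take i as @ [u, v] @ drop (Suc i) as))) = iter_sweedler (Suc n) x F"
proof -
  \<comment> \<open>a factor with number \<open>0\<close> is left as it is, the one with number \<open>1\<close> is split in two\<close>
  let ?ms = "replicate i 0 @ 1 # replicate (n - i) 0"
  have "iter_sweedler (n + sum_list ?ms) x F = iter_sweedler n x (\<lambda>as. nested_sweedler ?ms as F)"
    by (rule iter_sweedler_nested) (use assms in \<open>simp_all add: sum_list_replicate\<close>)
  also have "\<dots> = iter_sweedler n x (\<lambda>as. sweedler (as ! i)
      (\<lambda>u v. F (take i as @ [u, v] @ drop (Suc i) as)))"
  proof (rule iter_sweedler_cong)
    fix as :: "'v list" assume "length as = Suc n"
    then have as: "as = take i as @ as ! i # drop (Suc i) as"
      using assms(1) by (intro id_take_nth_drop) simp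
    have "nested_sweedler ?ms as F =
        nested_sweedler (1 # replicate (n - i) 0) (as ! i # drop (Suc i) as) (\<lambda>zs. F (take i as @ zs))"
      by (subst (1) as, rule nested_sweedler_replicate_0) (use \<open>length as = Suc n\<close> assms(1) in simp)
    also have "\<dots> = sweedler (as ! i) (\<lambda>u v. F (take i as @ [u, v] @ drop (Suc i) as))"
      using nested_sweedler_replicate_0[of "drop (Suc i) as" "n - i" "[]" "[]"] \<open>length as = Suc n\<close>
      by (simp add: iter_sweedler_Suc iter_sweedler_0)
    finally show "nested_sweedler ?ms as F =
        sweedler (as ! i) (\<lambda>u v. F (take i as @ [u, v] @ drop (Suc i) as))" .
  qed
  finally show ?thesis by (simp add: sum_list_replicate)
qed

end

section \<open>Homogeneous components and the unit\<close>

context graded_coalgebra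
begin

lemma is_decomposition_component: "is_decomposition C x (\<lambda>n. component C n x)"
  using theI'[OF C_direct_sum[of x]] unfolding component_def by simp

lemma component_in: "component C n x \<in> C n"
  and finite_components: "finite {n. component C n x \<noteq> 0}"
  and sum_components: "(\<Sum>n | component C n x \<noteq> 0. component C n x) = x"
  using is_decomposition_component[of x] by (auto simp: is_decomposition_def)

lemma sum_components_superset:
  "finite A \<Longrightarrow> {n. component C n x \<noteq> 0} \<subseteq> A \<Longrightarrow> (\<Sum>n\<in>A. component C n x) = x"
  by (subst sum.mono_neutral_right[of A "{n. component C n x \<noteq> 0}"]) (auto simp: sum_components)

lemma component_eqI:
  assumes "\<And>n. f n \<in> C n" "finite A" "\<And>n. n \<notin> A \<Longrightarrow> f n = 0" "x = (\<Sum>n\<in>A. f n)"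
  shows "component C n x = f n"
proof -
  have "finite {n. f n \<noteq> 0}" "{n. f n \<noteq> 0} \<subseteq> A"
    using assms(2,3) by (auto intro: finite_subset[of _ A])
  moreover have "(\<Sum>n\<in>A. f n) = (\<Sum>n | f n \<noteq> 0. f n)"
    by (rule sum.mono_neutral_right) (use assms(2,3) in auto)
  ultimately have "is_decomposition C x f"
    using assms(1,4) by (simp add: is_decomposition_def)
  then show ?thesis
    using C_direct_sum[of x] is_decomposition_component[of x] by (metis)
qed

lemma component_homogeneous: "x \<in> C n \<Longrightarrow> component C m x = (if m = n then x else 0)"
  by (rule component_eqI[of _ "{n}"]) (auto simp: subspace_0[OF C_subspace])

lemma component_add: "component C n (x + y) = component C n x + component C n y"
  by (rule component_eqI[of _ "{n. component C n x \<noteq> 0} \<union> {n. component C n y \<noteq> 0}"])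
    (auto simp: finite_components component_in subspace_add[OF C_subspace] sum.distrib
      sum_components_superset)

lemma component_scale: "component C n (scale c x) = scale c (component C n x)"
  by (rule component_eqI[of _ "{n. component C n x \<noteq> 0}"])
    (auto simp: finite_components component_in subspace_scale[OF C_subspace] sum_components
      simp flip: scale_sum_right)

lemma linear_component: "Vector_Spaces.linear scale scale (component C n)"
  by (simp add: Vector_Spaces.linear_iff component_add component_scale vector_space_axioms)

lemma functional_homogeneous_eq:
  assumes "functional scale \<phi>" "functional scale \<psi>" "\<And>n x. x \<in> C n \<Longrightarrow> \<phi> x = \<psi> x"
  shows "\<phi> x = \<psi> x"
proof -
  have "\<phi> (\<Sum>n | component C n x \<noteq> 0. component C n x) =
      \<psi> (\<Sum>n | component C n x \<noteq> 0. component C n x)"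
    unfolding functional_sum[OF assms(1)] functional_sum[OF assms(2)]
    by (intro sum.cong refl assms(3)[OF component_in])
  then show ?thesis by (simp add: sum_components)
qed

text \<open>
  Multilinear forms are determined by their values at homogeneous vectors. The slots are made
  homogeneous one after the other, from the left.
\<close>

lemma multilinear_homogeneous_eq:
  assumes F: "multilinear scale n F" and G: "multilinear scale n G"
    and eq: "\<And>xs. length xs = n \<Longrightarrow> \<forall>x\<in>set xs. \<exists>k. x \<in> C k \<Longrightarrow> F xs = G xs"
    and len: "length xs = n"
  shows "F xs = G xs"
proof -
  have "F (xs @ ys) = G (xs @ ys)" if "length xs + length ys = n" "\<forall>x\<in>set xs. \<exists>k. x \<in> C k" for xs ys
    using that
  proof (induction ys arbitrary: xs)
    case Nil
    then show ?case using eq[of xs] by simp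
  next
    case (Cons y ys)
    have "F (xs @ [z] @ ys) = G (xs @ [z] @ ys)" if "z \<in> C k" for z k
      using Cons.IH[of "xs @ [z]"] Cons.prems that by auto
    then show ?case
      using functional_homogeneous_eq[OF multilinear_slot[OF F, of xs ys] multilinear_slot[OF G, of xs ys]]
        Cons.prems by simp
  qed
  from this[of "[]" xs] len show ?thesis by simp
qed

text \<open>
  For homogeneous \<open>x\<close> the coproduct can be evaluated on one representative whose terms are homogeneous
  with degrees adding up to that of \<open>x\<close>.
\<close>

lemma sweedler_homogeneous:
  assumes "x \<in> C n"
  obtains t where "\<And>\<beta>. bilinear \<beta> \<Longrightarrow> sweedler x \<beta> = ev (\<lambda>p. \<beta> (p ! 0) (p ! 1)) t"
    and "\<And>p. p \<in> Poly_Mapping.keys t \<Longrightarrow> \<exists>i\<le>n. p ! 0 \<in> C i \<and> p ! 1 \<in> C (n - i)"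
proof -
  obtain t where t: "tensor_eq scale (Delta x) t"
      and keys: "Poly_Mapping.keys t \<subseteq> {[y, z] | y z i. i \<le> n \<and> y \<in> C i \<and> z \<in> C (n - i)}"
    using Delta_degree[OF assms] by blast
  have "t \<in> tensors 2" using keys by (auto simp: tensors_def)
  then have "sweedler x \<beta> = ev (\<lambda>p. \<beta> (p ! 0) (p ! 1)) t" if "bilinear \<beta>" for \<beta>
    unfolding sweedler_def
    by (intro ev_tensor_cong[OF vector_space_axioms t Delta_tensor _ multilinear_2[OF that]])
  moreover have "\<exists>i\<le>n. p ! 0 \<in> C i \<and> p ! 1 \<in> C (n - i)" if "p \<in> Poly_Mapping.keys t" for p
    using keys that by fastforce
  ultimately show thesis by (rule that)
qed

end

context connected_graded_coalgebra
begin

lemma bilinear_mult: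
  "functional scale \<phi> \<Longrightarrow> functional scale \<psi> \<Longrightarrow> bilinear (\<lambda>u v. \<phi> u * \<psi> v)"
  by (simp add: functional_times_left functional_times_right)

text \<open>
  The degree \<open>0\<close> part is a line, so it only has to be seen that the counit does not vanish on it. If it
  did, then the left counit axiom at a generator \<open>v\<close>, whose coproduct has both factors in degree \<open>0\<close>,
  would give \<open>v = 0\<close>.
\<close>

lemma degree_0_line: "\<exists>e\<in>C 0. eps e = 1 \<and> (\<forall>x\<in>C 0. x = scale (eps x) e)"
proof -
  obtain B where B: "B \<subseteq> C 0" "independent B" "C 0 \<subseteq> span B" "card B = 1"
    using basis_exists[of "C 0"] connected by metis
  then obtain v where v: "B = {v}" by (auto simp: card_1_singleton_iff)
  have "v \<in> C 0" "v \<noteq> 0" using B(1,2) v by (auto simp: dependent_zero)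
  have line: "\<exists>c. x = scale c v" if "x \<in> C 0" for x
    using that B(3) unfolding v by (auto simp: span_singleton)
  have eps_scale: "eps (scale c x) = c * eps x" for c x
    by (rule functional_scale[OF functional_eps])
  have "eps v \<noteq> 0"
  proof
    assume "eps v = 0"
    then have eps0: "eps x = 0" if "x \<in> C 0" for x
      using line[OF that] by (auto simp: eps_scale)
    obtain t where t: "\<And>\<beta>. bilinear \<beta> \<Longrightarrow> sweedler v \<beta> = ev (\<lambda>p. \<beta> (p ! 0) (p ! 1)) t"
        "\<And>p. p \<in> Poly_Mapping.keys t \<Longrightarrow> \<exists>i\<le>0. p ! 0 \<in> C i \<and> p ! 1 \<in> C (0 - i)"
      by (rule sweedler_homogeneous[OF \<open>v \<in> C 0\<close>]) blast
    have "\<phi> v = \<phi> 0" if \<phi>: "functional scale \<phi>" for \<phi>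
    proof -
      have "\<phi> v = ev (\<lambda>p. eps (p ! 0) * \<phi> (p ! 1)) t"
        using t(1)[OF bilinear_mult[OF functional_eps \<phi>]] sweedler_counit_left[OF \<phi>] by simp
      also have "\<dots> = ev (\<lambda>p. 0) t"
        using t(2) by (intro ev_cong) (auto simp: eps0)
      finally show ?thesis by (simp add: lin_ext_def functional_zero[OF \<phi>])
    qed
    then have "v = 0" by (rule functional_eqI[OF vector_space_axioms])
    with \<open>v \<noteq> 0\<close> show False by simp
  qed
  show ?thesis
  proof (intro bexI[of _ "scale (1 / eps v) v"] conjI ballI)
    show "scale (1 / eps v) v \<in> C 0" "eps (scale (1 / eps v) v) = 1"
      using \<open>eps v \<noteq> 0\<close> \<open>v \<in> C 0\<close> by (simp_all add: eps_scale subspace_scale[OF C_subspace])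
  next
    fix x assume "x \<in> C 0"
    with line obtain c where "x = scale c v" by blast
    with \<open>eps v \<noteq> 0\<close> show "x = scale (eps x) (scale (1 / eps v) v)" by (simp add: eps_scale)
  qed
qed

lemma unit_in: "unit_elem C eps \<in> C 0"
  and eps_unit: "eps (unit_elem C eps) = 1"
  and degree_0_eq: "x \<in> C 0 \<Longrightarrow> x = scale (eps x) (unit_elem C eps)"
proof -
  obtain e where e: "e \<in> C 0" "eps e = 1" "\<And>x. x \<in> C 0 \<Longrightarrow> x = scale (eps x) e"
    using degree_0_line by blast
  have unit: "unit_elem C eps = e"
    unfolding unit_elem_def
  proof (rule the_equality)
    show "e \<in> C 0 \<and> eps e = 1" using e(1,2) by blast
  next
    fix y assume "y \<in> C 0 \<and> eps y = 1"
    then show "y = e" using e(3)[of y] by simp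
  qed
  show "unit_elem C eps \<in> C 0" "eps (unit_elem C eps) = 1"
    unfolding unit by (fact e)+
  show "x = scale (eps x) (unit_elem C eps)" if "x \<in> C 0"
    unfolding unit using that by (rule e(3))
qed

text \<open>
  The unit is group-like: its coproduct is a multiple of \<open>1 \<otimes> 1\<close> because both factors lie on the line
  in degree \<open>0\<close>, and the counit axiom shows that the multiple is \<open>1\<close>.
\<close>

lemma sweedler_unit:
  assumes \<beta>: "bilinear \<beta>"
  shows "sweedler (unit_elem C eps) \<beta> = \<beta> (unit_elem C eps) (unit_elem C eps)"
proof -
  let ?e = "unit_elem C eps"
  obtain t where t: "\<And>\<beta>. bilinear \<beta> \<Longrightarrow> sweedler ?e \<beta> = ev (\<lambda>p. \<beta> (p ! 0) (p ! 1)) t"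
      "\<And>p. p \<in> Poly_Mapping.keys t \<Longrightarrow> \<exists>i\<le>0. p ! 0 \<in> C i \<and> p ! 1 \<in> C (0 - i)"
    by (rule sweedler_homogeneous[OF unit_in]) blast
  have "\<beta> u v = \<beta> ?e ?e * (eps u * eps v)" if "u \<in> C 0" "v \<in> C 0" for u v
  proof -
    have "\<beta> u v = \<beta> (scale (eps u) ?e) (scale (eps v) ?e)"
      by (intro arg_cong2[where f = \<beta>] degree_0_eq that)
    then show ?thesis
      using \<beta> by (simp add: functional_scale[of scale "\<lambda>u. \<beta> u _"] functional_scale[of scale "\<beta> _"])
  qed
  then have "sweedler ?e \<beta> = ev (\<lambda>p. \<beta> ?e ?e * (eps (p ! 0) * eps (p ! 1))) t"
    unfolding t(1)[OF \<beta>] using t(2) by (intro ev_cong) auto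
  also have "\<dots> = \<beta> ?e ?e * ev (\<lambda>p. eps (p ! 0) * eps (p ! 1)) t"
    by (rule ev_mult_left)
  also have "ev (\<lambda>p. eps (p ! 0) * eps (p ! 1)) t = 1"
    using t(1)[OF bilinear_mult[OF functional_eps functional_eps]]
      sweedler_counit_left[OF functional_eps, of ?e] by (simp add: eps_unit)
  finally show ?thesis by simp
qed

lemma iter_sweedler_unit:
  "multilinear scale (Suc n) F \<Longrightarrow>
     iter_sweedler n (unit_elem C eps) F = F (replicate (Suc n) (unit_elem C eps))"
proof (induction n arbitrary: F)
  case (Suc n)
  have "bilinear (\<lambda>u v. iter_sweedler n u (\<lambda>xs. F (xs @ [v])))"
    by (rule bilinear_iter_sweedler_snoc[OF Suc.prems])
  then show ?case
    using Suc.IH[OF multilinear_snoc[OF Suc.prems]]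
    by (simp add: iter_sweedler_Suc sweedler_unit replicate_append_same)
qed (simp add: iter_sweedler_0)

end

section \<open>The bialgebra of a Hopf operad\<close>

context graded_hopf_operad
begin

abbreviation mult :: "'v \<Rightarrow> 'v \<Rightarrow> 'v" where
  "mult \<equiv> operad_product scale D Delta gamma"

abbreviation unit :: 'v where
  "unit \<equiv> unit_elem D eps"

lemma gamma_linear_left:
  assumes "length ds = Suc n"
  shows "Vector_Spaces.linear scale scale (\<lambda>d. gamma (component D n d) ds)"
  using assms
  by (simp add: Vector_Spaces.linear_iff vector_space_axioms component_add component_scale
      gamma_add_left[OF component_in component_in] gamma_scale_left[OF component_in])

lemma functional_gamma_left:
  "length ds = Suc n \<Longrightarrow> functional scale \<phi> \<Longrightarrow> functional scale (\<lambda>d. \<phi> (gamma (component D n d) ds))"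
  by (rule functional_comp_linear[OF gamma_linear_left])

lemma multilinear_gamma:
  assumes "d \<in> D n" "functional scale \<phi>"
  shows "multilinear scale (Suc n) (\<lambda>ds. \<phi> (gamma d ds))"
proof (rule multilinearI)
  fix xs zs :: "'v list" assume "length xs + length zs + 1 = Suc n"
  then have "Vector_Spaces.linear scale scale (\<lambda>x. gamma d (xs @ x # zs))"
    using assms(1) by (simp add: Vector_Spaces.linear_iff vector_space_axioms gamma_add gamma_scale)
  then show "functional scale (\<lambda>x. \<phi> (gamma d (xs @ x # zs)))"
    using assms(2) by (rule functional_comp_linear)
qed

lemma gamma_0: "length ds = Suc n \<Longrightarrow> gamma 0 ds = 0"
  using gamma_scale_left[of 0 n ds 0] subspace_0[OF C_subspace[of n]] by simp

text \<open>
  Enlarging the range of summation to any finite \<open>A\<close> allows the products of several right factors to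
  be written over the same set of degrees, which gives additivity in \<open>b\<close>. With \<open>A = {n}\<close> the product by
  a factor of degree \<open>n\<close> is a single term, also when that factor is zero.
\<close>

lemma mult_eq_sum:
  assumes \<phi>: "functional scale \<phi>" and A: "finite A" "{n. component D n b \<noteq> 0} \<subseteq> A"
  shows "\<phi> (mult a b) = (\<Sum>n\<in>A. iter_sweedler n a (\<lambda>xs. \<phi> (gamma (component D n b) xs)))"
proof -
  have "\<phi> (mult a b) =
      (\<Sum>n | component D n b \<noteq> 0. iter_sweedler n a (\<lambda>xs. \<phi> (gamma (component D n b) xs)))"
    unfolding operad_product_def functional_sum[OF \<phi>] linear_comp_lin_ext[OF \<phi>] iter_sweedler_def ..
  also have "\<dots> = (\<Sum>n\<in>A. iter_sweedler n a (\<lambda>xs. \<phi> (gamma (component D n b) xs)))"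
  proof (rule sum.mono_neutral_left[OF A], rule ballI)
    fix n assume "n \<in> A - {n. component D n b \<noteq> 0}"
    then have "iter_sweedler n a (\<lambda>xs. \<phi> (gamma (component D n b) xs)) = iter_sweedler n a (\<lambda>xs. 0)"
      by (intro iter_sweedler_cong) (simp add: gamma_0[of _ n] functional_zero[OF \<phi>])
    then show "iter_sweedler n a (\<lambda>xs. \<phi> (gamma (component D n b) xs)) = 0"
      by (simp add: iter_sweedler_def lin_ext_def)
  qed
  finally show ?thesis .
qed

lemma mult_homogeneous:
  assumes "functional scale \<phi>" "b \<in> D n"
  shows "\<phi> (mult a b) = iter_sweedler n a (\<lambda>xs. \<phi> (gamma b xs))"
proof -
  have "{m. component D m b \<noteq> 0} \<subseteq> {n}" by (auto simp: component_homogeneous[OF assms(2)])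
  then show ?thesis
    using mult_eq_sum[OF assms(1), of "{n}" b a] by (simp add: component_homogeneous[OF assms(2)])
qed

lemma linear_mult_left: "Vector_Spaces.linear scale scale (\<lambda>a. mult a b)"
proof (rule linearI_functional[OF vector_space_axioms])
  fix \<phi> assume \<phi>: "functional scale \<phi>"
  show "functional scale (\<lambda>a. \<phi> (mult a b))"
    unfolding mult_eq_sum[OF \<phi> finite_components subset_refl]
    by (intro functional_sum_param functional_iter_sweedler multilinear_gamma component_in \<phi>)
qed

lemma linear_mult_right: "Vector_Spaces.linear scale scale (mult a)"
proof (rule linearI_functional[OF vector_space_axioms])
  fix \<phi> assume \<phi>: "functional scale \<phi>"
  let ?F = "\<lambda>n b. iter_sweedler n a (\<lambda>xs. \<phi> (gamma (component D n b) xs))"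
  have F: "functional scale (?F n)" for n
    by (intro functional_iter_sweedler_param functional_gamma_left \<phi>)
  let ?S = "\<lambda>b. {n. component D n b \<noteq> 0}"
  show "functional scale (\<lambda>b. \<phi> (mult a b))"
  proof (rule scale_functionalI)
    fix x y
    let ?A = "?S x \<union> ?S y"
    have "?S (x + y) \<subseteq> ?A" by (auto simp: component_add)
    then show "\<phi> (mult a (x + y)) = \<phi> (mult a x) + \<phi> (mult a y)"
      by (simp add: mult_eq_sum[OF \<phi>, of ?A] finite_components functional_add[OF F] sum.distrib)
  next
    fix c x
    have "?S (scale c x) \<subseteq> ?S x" by (auto simp: component_scale)
    then show "\<phi> (mult a (scale c x)) = c * \<phi> (mult a x)"
      by (simp add: mult_eq_sum[OF \<phi>, of "?S x"] finite_components functional_scale[OF F]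
          sum_distrib_left)
  qed
qed

lemmas functional_mult_fst = functional_comp_linear[OF linear_mult_left]
lemmas functional_mult_snd = functional_comp_linear[OF linear_mult_right]

text \<open>
  The iterated coproduct of the unit is the pure tensor \<open>1 \<otimes> \<dots> \<otimes> 1\<close>, and \<open>\<gamma>(b; 1, \<dots>, 1) = b\<close>.
\<close>

lemma mult_unit_left: "mult unit b = b"
proof (rule functional_eqI[OF vector_space_axioms])
  fix \<phi> assume \<phi>: "functional scale \<phi>"
  show "\<phi> (mult unit b) = \<phi> b"
  proof (rule functional_homogeneous_eq[OF functional_mult_snd[OF \<phi>] \<phi>])
    fix n x assume "x \<in> D n"
    then show "\<phi> (mult unit x) = \<phi> x"
      using gamma_unit_right[of x n] iter_sweedler_unit[OF multilinear_gamma[OF _ \<phi>]]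
      by (simp add: mult_homogeneous[OF \<phi>])
  qed
qed

lemma mult_unit_right: "mult a unit = a"
proof (rule functional_eqI[OF vector_space_axioms])
  fix \<phi> assume \<phi>: "functional scale \<phi>"
  show "\<phi> (mult a unit) = \<phi> a"
    by (rule functional_homogeneous_eq[OF functional_mult_fst[OF \<phi>] \<phi>])
      (simp add: mult_homogeneous[OF \<phi> unit_in] iter_sweedler_0 gamma_unit_left)
qed

lemma eps_mult: "eps (mult a b) = eps a * eps b"
proof (rule functional_homogeneous_eq[OF functional_mult_snd[OF functional_eps]
      functional_times_left[OF functional_eps]])
  fix n b assume b: "b \<in> D n"
  have "eps (mult a b) = iter_sweedler n a (\<lambda>xs. eps b * prod_list (map eps xs))"
    unfolding mult_homogeneous[OF functional_eps b]
    by (rule iter_sweedler_cong) (simp add: gamma_counit[OF b] comp_counit_def)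
  also have "\<dots> = eps b * iter_sweedler n a (\<lambda>xs. prod_list (map eps xs))"
    by (simp add: iter_sweedler_def ev_mult_left)
  finally show "eps (mult a b) = eps a * eps b"
    by (simp add: iter_sweedler_eps mult.commute)
qed

text \<open>
  The axiom that \<open>\<gamma>\<close> is a coalgebra map, as an equality of Sweedler sums.
\<close>

lemma sweedler_gamma:
  assumes "d \<in> D n" "length ds = Suc n" "bilinear \<beta>"
  shows "sweedler (gamma d ds) \<beta> =
    (\<Sum>i<Suc n. sweedler d (\<lambda>d' d''. sweedler (ds ! i) (\<lambda>u v.
        \<beta> (gamma (component D i d') (take i ds @ [u]))
          (gamma (component D (n - i) d'') (v # drop (Suc i) ds)))))"
proof -
  let ?R = "lin_ext fscale (\<lambda>((a, as), (b, bs)). pure [gamma a as, gamma b bs])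
             (comp_coproduct D Delta Delta d ds)"
  have "?R \<in> tensors 2"
    by (rule tensors_lin_ext) (auto simp: tensors_pure)
  then have "sweedler (gamma d ds) \<beta> = ev (\<lambda>p. \<beta> (p ! 0) (p ! 1)) ?R"
    unfolding sweedler_def using gamma_coproduct[of d n ds] assms
    by (intro ev_tensor_cong[OF vector_space_axioms _ Delta_tensor _ multilinear_2]) auto
  then show ?thesis
    using assms(2)
    by (simp add: ev_lin_ext comp_coproduct_def ev_sum_right sweedler_def del: sum.lessThan_Suc)
qed

text \<open>
  For \<open>x\<close> of degree \<open>n\<close> the coproduct is the sum of its parts in degrees \<open>(i, n - i)\<close>.
\<close>

lemma sweedler_sum_components:
  assumes "x \<in> D n" "bilinear \<beta>"
  shows "(\<Sum>i<Suc n. sweedler x (\<lambda>u v. \<beta> (component D i u) (component D (n - i) v))) = sweedler x \<beta>"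
proof -
  obtain t where t: "\<And>\<beta>. bilinear \<beta> \<Longrightarrow> sweedler x \<beta> = ev (\<lambda>p. \<beta> (p ! 0) (p ! 1)) t"
      "\<And>p. p \<in> Poly_Mapping.keys t \<Longrightarrow> \<exists>i\<le>n. p ! 0 \<in> D i \<and> p ! 1 \<in> D (n - i)"
    by (rule sweedler_homogeneous[OF assms(1)]) blast
  have b: "bilinear (\<lambda>u v. \<beta> (component D i u) (component D (n - i) v))" for i
    using assms(2) functional_comp_linear[OF linear_component, of "\<lambda>u. \<beta> u _"]
      functional_comp_linear[OF linear_component, of "\<beta> _"] by auto
  have "(\<Sum>i<Suc n. \<beta> (component D i u) (component D (n - i) v)) = \<beta> u v"
    if "j \<le> n" "u \<in> D j" "v \<in> D (n - j)" for j u v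
  proof -
    have "(\<Sum>i<Suc n. \<beta> (component D i u) (component D (n - i) v)) =
        (\<Sum>i<Suc n. if i = j then \<beta> u v else 0)"
      using that assms(2) functional_zero[of scale "\<lambda>u. \<beta> u _"]
      by (intro sum.cong) (auto simp: component_homogeneous)
    then show ?thesis using that by simp
  qed
  then have "ev (\<lambda>p. \<Sum>i<Suc n. \<beta> (component D i (p ! 0)) (component D (n - i) (p ! 1))) t =
      ev (\<lambda>p. \<beta> (p ! 0) (p ! 1)) t"
    using t(2) by (intro ev_cong) blast
  then show ?thesis
    unfolding t(1)[OF b] t(1)[OF assms(2)] by (simp only: ev_sum_left)
qed

text \<open>
  Multiplicativity of the coproduct. In the coproduct of \<open>\<gamma>(b; a\<^sub>0, \<dots>, a\<^sub>n)\<close> the form \<open>?G\<close> below is evaluated at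
  the list in which \<open>a\<^sub>i\<close> is replaced by its two parts. By \<open>iter_sweedler_insert\<close> this list runs over the
  iterated coproduct of \<open>a\<close> with \<open>n + 2\<close> factors, and \<open>iter_sweedler_split\<close> distributes these over the two
  arguments of \<open>\<beta>\<close>.
\<close>

lemma sweedler_mult:
  assumes \<beta>: "bilinear \<beta>"
  shows "sweedler (mult a b) \<beta> =
    sweedler a (\<lambda>a' a''. sweedler b (\<lambda>b' b''. \<beta> (mult a' b') (mult a'' b'')))"
proof -
  have \<beta>1: "functional scale (\<lambda>u. \<beta> u v)" and \<beta>2: "functional scale (\<beta> u)" for u v
    using \<beta> by auto
  have \<beta>m: "bilinear (\<lambda>b' b''. \<beta> (mult a' b') (mult a'' b''))" for a' a''
    by (intro conjI allI functional_mult_snd[OF \<beta>1] functional_mult_snd[OF \<beta>2])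
  show ?thesis
  proof (rule functional_homogeneous_eq[of "\<lambda>b. sweedler (mult a b) \<beta>"])
    show "functional scale (\<lambda>b. sweedler (mult a b) \<beta>)"
      by (rule functional_mult_snd[OF functional_sweedler[OF \<beta>]])
    show "functional scale (\<lambda>b.
        sweedler a (\<lambda>a' a''. sweedler b (\<lambda>b' b''. \<beta> (mult a' b') (mult a'' b''))))"
      by (intro functional_sweedler_param functional_sweedler \<beta>m)
  next
    fix n b assume b: "b \<in> D n"
    let ?G = "\<lambda>i b' b'' zs. \<beta> (gamma (component D i b') (take (Suc i) zs))
        (gamma (component D (n - i) b'') (drop (Suc i) zs))"
    have G: "multilinear scale (Suc i + Suc (n - i)) (?G i b' b'')" for i b' b''
      by (intro multilinear_take_drop multilinear_gamma component_in \<beta>1 \<beta>2)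
    have "sweedler (mult a b) \<beta> = iter_sweedler n a (\<lambda>as. sweedler (gamma b as) \<beta>)"
      by (rule mult_homogeneous[OF functional_sweedler[OF \<beta>] b])
    also have "\<dots> = iter_sweedler n a (\<lambda>as. \<Sum>i<Suc n. sweedler b (\<lambda>b' b''. sweedler (as ! i)
        (\<lambda>u v. ?G i b' b'' (take i as @ [u, v] @ drop (Suc i) as))))"
      by (intro iter_sweedler_cong) (simp add: sweedler_gamma[OF b _ \<beta>])
    also have "\<dots> = (\<Sum>i<Suc n. sweedler b (\<lambda>b' b''. iter_sweedler n a (\<lambda>as. sweedler (as ! i)
        (\<lambda>u v. ?G i b' b'' (take i as @ [u, v] @ drop (Suc i) as)))))"
      unfolding sweedler_iter_swap by (simp only: iter_sweedler_def ev_sum_left)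
    also have "\<dots> = (\<Sum>i<Suc n. sweedler b (\<lambda>b' b''. sweedler a (\<lambda>a' a''.
        \<beta> (mult a' (component D i b')) (mult a'' (component D (n - i) b'')))))"
    proof (intro sum.cong refl arg_cong[where f = "sweedler b"] ext)
      fix i b' b'' assume "i \<in> {..<Suc n}"
      then have i: "i \<le> n" by simp
      have "iter_sweedler n a (\<lambda>as. sweedler (as ! i)
          (\<lambda>u v. ?G i b' b'' (take i as @ [u, v] @ drop (Suc i) as))) =
          iter_sweedler (Suc (i + (n - i))) a (?G i b' b'')"
        using iter_sweedler_insert[OF i, of "?G i b' b''" a] G[of i b' b''] i by simp
      also have "\<dots> = sweedler a (\<lambda>a' a''. iter_sweedler i a' (\<lambda>xs. iter_sweedler (n - i) a''
          (\<lambda>ys. ?G i b' b'' (xs @ ys))))"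
        by (rule iter_sweedler_split) (use G[of i b' b''] in simp)
      also have "\<dots> = sweedler a (\<lambda>a' a''. iter_sweedler i a' (\<lambda>xs. iter_sweedler (n - i) a''
          (\<lambda>ys. \<beta> (gamma (component D i b') xs) (gamma (component D (n - i) b'') ys))))"
        by (intro arg_cong[where f = "sweedler a"] ext iter_sweedler_cong) simp
      also have "\<dots> = sweedler a (\<lambda>a' a''.
          \<beta> (mult a' (component D i b')) (mult a'' (component D (n - i) b'')))"
        unfolding mult_homogeneous[OF \<beta>2 component_in, symmetric]
        unfolding mult_homogeneous[OF \<beta>1 component_in, symmetric] ..
      finally show "iter_sweedler n a (\<lambda>as. sweedler (as ! i)
          (\<lambda>u v. ?G i b' b'' (take i as @ [u, v] @ drop (Suc i) as))) =
          sweedler a (\<lambda>a' a''. \<beta> (mult a' (component D i b')) (mult a'' (component D (n - i) b'')))" .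
    qed
    also have "\<dots> = sweedler b (\<lambda>b' b''. sweedler a (\<lambda>a' a''. \<beta> (mult a' b') (mult a'' b'')))"
      by (rule sweedler_sum_components[OF b])
        (intro conjI allI functional_sweedler_param functional_mult_snd[OF \<beta>1] functional_mult_snd[OF \<beta>2])
    also have "\<dots> = sweedler a (\<lambda>a' a''. sweedler b (\<lambda>b' b''. \<beta> (mult a' b') (mult a'' b'')))"
      by (rule sweedler_swap)
    finally show "sweedler (mult a b) \<beta> =
        sweedler a (\<lambda>a' a''. sweedler b (\<lambda>b' b''. \<beta> (mult a' b') (mult a'' b'')))" .
  qed
qed

text \<open>
  Multiplicativity of the iterated coproduct, by iterating \<open>sweedler_mult\<close>.
\<close>

lemma iter_sweedler_mult:
  "multilinear scale (Suc n) F \<Longrightarrow> iter_sweedler n (mult a b) F =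
     iter_sweedler n a (\<lambda>as. iter_sweedler n b (\<lambda>bs. F (map2 mult as bs)))"
proof (induction n arbitrary: a b F)
  case 0
  show ?case by (simp add: iter_sweedler_0)
next
  case (Suc n)
  have "iter_sweedler (Suc n) (mult a b) F =
      sweedler a (\<lambda>a' a''. sweedler b (\<lambda>b' b''.
        iter_sweedler n (mult a' b') (\<lambda>xs. F (xs @ [mult a'' b'']))))"
    unfolding iter_sweedler_Suc by (rule sweedler_mult[OF bilinear_iter_sweedler_snoc[OF Suc.prems]])
  also have "\<dots> = sweedler a (\<lambda>a' a''. sweedler b (\<lambda>b' b''.
        iter_sweedler n a' (\<lambda>as. iter_sweedler n b' (\<lambda>bs. F (map2 mult as bs @ [mult a'' b''])))))"
    unfolding Suc.IH[OF multilinear_snoc[OF Suc.prems]] ..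
  also have "\<dots> = sweedler a (\<lambda>a' a''. iter_sweedler n a' (\<lambda>as. sweedler b (\<lambda>b' b''.
        iter_sweedler n b' (\<lambda>bs. F (map2 mult as bs @ [mult a'' b''])))))"
    unfolding sweedler_iter_swap[of b] ..
  also have "\<dots> = sweedler a (\<lambda>a' a''. iter_sweedler n a' (\<lambda>as. sweedler b (\<lambda>b' b''.
        iter_sweedler n b' (\<lambda>bs. F (map2 mult (as @ [a'']) (bs @ [b'']))))))"
    by (intro arg_cong[where f = "sweedler _"] ext iter_sweedler_cong) simp
  finally show ?case unfolding iter_sweedler_Suc .
qed

text \<open>
  Products with homogeneous right factors can be formed in all slots at once: if \<open>F\<close> at a concatenation
  depends on its blocks only through \<open>\<gamma>(b\<^sub>i; block\<^sub>i)\<close>, then summing each block over the iterated coproduct of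
  \<open>a\<^sub>i\<close> turns \<open>\<gamma>(b\<^sub>i; block\<^sub>i)\<close> into \<open>a\<^sub>i \<cdot> b\<^sub>i\<close>.
\<close>

lemma nested_sweedler_gamma:
  assumes "list_all2 (\<lambda>b m. b \<in> D m) bs ms" "length as = length ms"
    and "multilinear scale (length ms) H"
    and "\<And>ess. list_all2 (\<lambda>es m. length es = Suc m) ess ms \<Longrightarrow> F (concat ess) = H (map2 gamma bs ess)"
  shows "nested_sweedler ms as F = H (map2 mult as bs)"
  using assms
proof (induction bs ms arbitrary: as F H rule: list_all2_induct)
  case Nil
  then show ?case by simp
next
  case (Cons b bs m ms)
  obtain a as' where as: "as = a # as'" "length as' = length ms"
    using Cons.prems(1) by (cases as) auto
  have len: "length (map2 mult as' bs) = length ms"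
    using as(2) list_all2_lengthD[OF Cons.hyps(2)] by simp
  have H: "multilinear scale (Suc (length ms)) H" using Cons.prems(2) by simp
  have "nested_sweedler (m # ms) as F =
      iter_sweedler m a (\<lambda>xs. nested_sweedler ms as' (\<lambda>ys. F (xs @ ys)))"
    by (simp add: as)
  also have "\<dots> = iter_sweedler m a (\<lambda>xs. H (gamma b xs # map2 mult as' bs))"
  proof (intro iter_sweedler_cong Cons.IH as(2) multilinear_Cons[OF H])
    fix xs :: "'v list" and ess :: "'v list list"
    assume "length xs = Suc m" "list_all2 (\<lambda>es m. length es = Suc m) ess ms"
    then show "F (xs @ concat ess) = H (gamma b xs # map2 gamma bs ess)"
      using Cons.prems(3)[of "xs # ess"] by simp
  qed
  also have "\<dots> = H (mult a b # map2 mult as' bs)"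
    by (rule mult_homogeneous[symmetric, OF multilinear_hd[OF H len] Cons.hyps(1)])
  finally show ?case by (simp add: as)
qed

text \<open>
  The distributive law \<open>a \<cdot> \<gamma>(c; b\<^sub>0, \<dots>, b\<^sub>n) = \<gamma>(c; a\<^sub>0 \<cdot> b\<^sub>0, \<dots>, a\<^sub>n \<cdot> b\<^sub>n)\<close>. For homogeneous \<open>b\<^sub>i\<close> of degree \<open>m\<^sub>i\<close> the
  element \<open>\<gamma>(c; b\<^sub>0, \<dots>, b\<^sub>n)\<close> has degree \<open>n + m\<^sub>0 + \<dots> + m\<^sub>n\<close>, so the left side splits \<open>a\<close> into \<open>m\<^sub>0 + 1\<close> up to
  \<open>m\<^sub>n + 1\<close> factors in a row. Splitting in two stages and associativity of \<open>\<gamma>\<close> give the right side.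
\<close>

lemma mult_gamma:
  assumes c: "c \<in> D n" and len: "length bs = Suc n" and \<phi>: "functional scale \<phi>"
  shows "\<phi> (mult a (gamma c bs)) = iter_sweedler n a (\<lambda>as. \<phi> (gamma c (map2 mult as bs)))"
proof (rule multilinear_homogeneous_eq[where F = "\<lambda>bs. \<phi> (mult a (gamma c bs))"
      and G = "\<lambda>bs. iter_sweedler n a (\<lambda>as. \<phi> (gamma c (map2 mult as bs)))", OF _ _ _ len])
  show "multilinear scale (Suc n) (\<lambda>bs. \<phi> (mult a (gamma c bs)))"
    by (rule multilinear_gamma[OF c functional_mult_snd[OF \<phi>]])
  show "multilinear scale (Suc n) (\<lambda>bs. iter_sweedler n a (\<lambda>as. \<phi> (gamma c (map2 mult as bs))))"
    by (rule multilinear_iter_sweedler_param,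
        rule multilinear_map2[where F = "\<lambda>xs. \<phi> (gamma c xs)"],
        rule multilinear_gamma[OF c \<phi>], assumption, rule functional_mult_snd)
next
  fix bs assume len: "length bs = Suc n" and hom: "\<forall>b\<in>set bs. \<exists>k. b \<in> D k"
  define ms where "ms = map (\<lambda>b. SOME k. b \<in> D k) bs"
  have bs: "list_all2 (\<lambda>b m. b \<in> D m) bs ms"
    unfolding ms_def list_all2_conv_all_nth using someI_ex[OF hom[rule_format, OF nth_mem]] by simp
  have ms: "length ms = Suc n" by (simp add: ms_def len)
  have deg: "gamma c bs \<in> D (n + sum_list ms)"
    using bs by (intro gamma_degree c) (auto simp: len ms list_all2_conv_all_nth)
  have "\<phi> (mult a (gamma c bs)) =
      iter_sweedler (n + sum_list ms) a (\<lambda>es. \<phi> (gamma (gamma c bs) es))"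
    by (rule mult_homogeneous[OF \<phi> deg])
  also have "\<dots> = iter_sweedler n a (\<lambda>as. nested_sweedler ms as (\<lambda>es. \<phi> (gamma (gamma c bs) es)))"
    by (rule iter_sweedler_nested[OF ms]) (use multilinear_gamma[OF deg \<phi>] in simp)
  also have "\<dots> = iter_sweedler n a (\<lambda>as. \<phi> (gamma c (map2 mult as bs)))"
  proof (intro iter_sweedler_cong nested_sweedler_gamma[OF bs, where H = "\<lambda>xs. \<phi> (gamma c xs)"])
    show "multilinear scale (length ms) (\<lambda>xs. \<phi> (gamma c xs))"
      unfolding ms by (rule multilinear_gamma[OF c \<phi>])
  next
    fix ess :: "'v list list" assume "list_all2 (\<lambda>es m. length es = Suc m) ess ms"
    then have "gamma (gamma c bs) (concat ess) = gamma c (map2 gamma bs ess)"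
      using bs ms by (intro gamma_assoc[OF c, of _ ms]) (auto simp: len list_all2_conv_all_nth)
    then show "\<phi> (gamma (gamma c bs) (concat ess)) = \<phi> (gamma c (map2 gamma bs ess))" by simp
  qed (simp add: ms)
  finally show "\<phi> (mult a (gamma c bs)) = iter_sweedler n a (\<lambda>as. \<phi> (gamma c (map2 mult as bs)))" .
qed

lemma mult_assoc: "mult (mult a b) c = mult a (mult b c)"
proof (rule functional_eqI[OF vector_space_axioms])
  fix \<phi> assume \<phi>: "functional scale \<phi>"
  note \<phi>a = functional_mult_snd[OF \<phi>, of a]
  show "\<phi> (mult (mult a b) c) = \<phi> (mult a (mult b c))"
  proof (rule functional_homogeneous_eq[OF functional_mult_snd[OF \<phi>] functional_mult_snd[OF \<phi>a]])
    fix n c assume c: "c \<in> D n"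
    \<comment> \<open>both sides are sums of \<open>\<gamma>(c; a\<^sub>0 \<cdot> b\<^sub>0, \<dots>, a\<^sub>n \<cdot> b\<^sub>n)\<close>, taken in different orders\<close>
    have "\<phi> (mult (mult a b) c) =
        iter_sweedler n a (\<lambda>as. iter_sweedler n b (\<lambda>bs. \<phi> (gamma c (map2 mult as bs))))"
      unfolding mult_homogeneous[OF \<phi> c] by (rule iter_sweedler_mult[OF multilinear_gamma[OF c \<phi>]])
    also have "\<dots> = iter_sweedler n b (\<lambda>bs. iter_sweedler n a (\<lambda>as. \<phi> (gamma c (map2 mult as bs))))"
      by (rule iter_sweedler_swap)
    also have "\<dots> = iter_sweedler n b (\<lambda>bs. \<phi> (mult a (gamma c bs)))"
      by (intro iter_sweedler_cong) (simp add: mult_gamma[OF c _ \<phi>])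
    also have "\<dots> = \<phi> (mult a (mult b c))"
      by (rule mult_homogeneous[symmetric, OF \<phi>a c])
    finally show "\<phi> (mult (mult a b) c) = \<phi> (mult a (mult b c))" .
  qed
qed

end

section \<open>The antipode of a connected coalgebra with a product\<close>

text \<open>
  A unital associative product on a connected graded coalgebra makes the linear endomorphisms an
  algebra under convolution, with unit \<open>\<eta>\<epsilon>\<close>. An antipode is an inverse of the identity in this algebra.
\<close>

locale algebra_on_connected_coalgebra = connected_graded_coalgebra scale C Delta eps
  for scale :: "'k::field_char_0 \<Rightarrow> 'v::ab_group_add \<Rightarrow> 'v"
    and C :: "nat \<Rightarrow> 'v set"
    and Delta :: "'v \<Rightarrow> ('v list \<Rightarrow>\<^sub>0 'k)"
    and eps :: "'v \<Rightarrow> 'k" +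
  fixes prod :: "'v \<Rightarrow> 'v \<Rightarrow> 'v"
  assumes linear_prod_left: "Vector_Spaces.linear scale scale (\<lambda>a. prod a b)"
    and linear_prod_right: "Vector_Spaces.linear scale scale (prod a)"
    and prod_assoc: "prod (prod a b) c = prod a (prod b c)"
    and prod_unit_left: "prod (unit_elem C eps) a = a"
    and prod_unit_right: "prod a (unit_elem C eps) = a"
begin

abbreviation endomorphism :: "('v \<Rightarrow> 'v) \<Rightarrow> bool" where
  "endomorphism \<equiv> Vector_Spaces.linear scale scale"

definition convolution :: "('v \<Rightarrow> 'v) \<Rightarrow> ('v \<Rightarrow> 'v) \<Rightarrow> 'v \<Rightarrow> 'v" where
  "convolution f g x = lin_ext scale (\<lambda>p. prod (f (p ! 0)) (g (p ! 1))) (Delta x)"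

definition unit_counit :: "'v \<Rightarrow> 'v" where
  "unit_counit x = scale (eps x) (unit_elem C eps)"

definition counit_minus_id :: "'v \<Rightarrow> 'v" where
  "counit_minus_id x = unit_counit x - x"

primrec conv_power :: "nat \<Rightarrow> 'v \<Rightarrow> 'v" where
  "conv_power 0 = unit_counit"
| "conv_power (Suc k) = convolution (conv_power k) counit_minus_id"

lemmas functional_prod_left = functional_comp_linear[OF linear_prod_left]
lemmas functional_prod_right = functional_comp_linear[OF linear_prod_right]

lemma functional_convolution:
  "functional scale \<phi> \<Longrightarrow> \<phi> (convolution f g x) = sweedler x (\<lambda>u v. \<phi> (prod (f u) (g v)))"
  unfolding convolution_def sweedler_def by (rule linear_comp_lin_ext)

lemma bilinear_convolution:
  assumes "functional scale \<phi>" "endomorphism f" "endomorphism g"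
  shows "bilinear (\<lambda>u v. \<phi> (prod (f u) (g v)))"
  using assms(1) functional_comp_linear[OF assms(2) functional_prod_left]
    functional_comp_linear[OF assms(3) functional_prod_right] by blast

lemma endomorphism_convolution:
  assumes "endomorphism f" "endomorphism g" shows "endomorphism (convolution f g)"
proof (rule linearI_functional[OF vector_space_axioms])
  fix \<phi> assume \<phi>: "functional scale \<phi>"
  show "functional scale (\<lambda>x. \<phi> (convolution f g x))"
    unfolding functional_convolution[OF \<phi>]
    by (rule functional_sweedler[OF bilinear_convolution[OF \<phi> assms]])
qed

lemma endomorphism_unit_counit: "endomorphism unit_counit"
  by (simp add: Vector_Spaces.linear_iff vector_space_axioms unit_counit_def scale_left_distrib
      functional_add[OF functional_eps] functional_scale[OF functional_eps])

lemma endomorphism_counit_minus_id: "endomorphism counit_minus_id"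
  using endomorphism_unit_counit
  by (simp add: Vector_Spaces.linear_iff counit_minus_id_def scale_right_diff_distrib)

lemma endomorphism_conv_power: "endomorphism (conv_power k)"
  by (induction k)
    (simp_all add: endomorphism_unit_counit endomorphism_convolution endomorphism_counit_minus_id)

lemma convolution_unit_left:
  assumes "endomorphism f" shows "convolution unit_counit f = f"
proof (intro ext functional_eqI[OF vector_space_axioms])
  fix \<phi> x assume \<phi>: "functional scale \<phi>"
  have "\<phi> (prod (unit_counit u) (f v)) = eps u * \<phi> (f v)" for u v
    unfolding unit_counit_def functional_scale[OF functional_prod_left[OF \<phi>]] prod_unit_left ..
  then show "\<phi> (convolution unit_counit f x) = \<phi> (f x)"
    by (simp add: functional_convolution[OF \<phi>] sweedler_counit_left functional_comp_linear[OF assms \<phi>])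
qed

lemma convolution_unit_right:
  assumes "endomorphism f" shows "convolution f unit_counit = f"
proof (intro ext functional_eqI[OF vector_space_axioms])
  fix \<phi> x assume \<phi>: "functional scale \<phi>"
  have "\<phi> (prod (f u) (unit_counit v)) = \<phi> (f u) * eps v" for u v
    unfolding unit_counit_def functional_scale[OF functional_prod_right[OF \<phi>]] prod_unit_right
    by (rule mult.commute)
  then show "\<phi> (convolution f unit_counit x) = \<phi> (f x)"
    by (simp add: functional_convolution[OF \<phi>] sweedler_counit_right functional_comp_linear[OF assms \<phi>])
qed

lemma convolution_assoc:
  assumes f: "endomorphism f" and g: "endomorphism g" and h: "endomorphism h"
  shows "convolution (convolution f g) h = convolution f (convolution g h)"
proof (intro ext functional_eqI[OF vector_space_axioms])
  fix \<phi> x assume \<phi>: "functional scale \<phi>"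
  let ?T = "\<lambda>u v w. \<phi> (prod (f u) (prod (g v) (h w)))"
  have "\<phi> (convolution (convolution f g) h x) = sweedler x (\<lambda>u w. sweedler u (\<lambda>p q. ?T p q w))"
    unfolding functional_convolution[OF \<phi>]
    unfolding functional_convolution[OF functional_prod_left[OF \<phi>]] prod_assoc ..
  also have "\<dots> = sweedler x (\<lambda>u w. sweedler w (\<lambda>p q. ?T u p q))"
    by (intro sweedler_coassoc functional_comp_linear[OF f] functional_comp_linear[OF g]
        functional_comp_linear[OF h] functional_prod_left functional_prod_right \<phi>)
  also have "\<dots> = \<phi> (convolution f (convolution g h) x)"
    unfolding functional_convolution[OF \<phi>]
    unfolding functional_convolution[OF functional_prod_right[OF \<phi>]] ..
  finally show "\<phi> (convolution (convolution f g) h x) = \<phi> (convolution f (convolution g h) x)" .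
qed

text \<open>
  In degree \<open>n\<close> only the values in degrees up to \<open>n\<close> matter. This is how the infinite sum defining the
  antipode is replaced by a partial sum.
\<close>

lemma convolution_homogeneous_cong:
  assumes x: "x \<in> C n"
    and "endomorphism f" "endomorphism g" "endomorphism f'" "endomorphism g'"
    and eq: "\<And>i u v. i \<le> n \<Longrightarrow> u \<in> C i \<Longrightarrow> v \<in> C (n - i) \<Longrightarrow> prod (f u) (g v) = prod (f' u) (g' v)"
  shows "convolution f g x = convolution f' g' x"
proof (rule functional_eqI[OF vector_space_axioms])
  fix \<phi> assume \<phi>: "functional scale \<phi>"
  obtain t where t: "\<And>\<beta>. bilinear \<beta> \<Longrightarrow> sweedler x \<beta> = ev (\<lambda>p. \<beta> (p ! 0) (p ! 1)) t"
      "\<And>p. p \<in> Poly_Mapping.keys t \<Longrightarrow> \<exists>i\<le>n. p ! 0 \<in> C i \<and> p ! 1 \<in> C (n - i)"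
    by (rule sweedler_homogeneous[OF x]) blast
  have "ev (\<lambda>p. \<phi> (prod (f (p ! 0)) (g (p ! 1)))) t = ev (\<lambda>p. \<phi> (prod (f' (p ! 0)) (g' (p ! 1)))) t"
    using t(2) eq by (intro ev_cong arg_cong[where f = \<phi>]) blast
  then show "\<phi> (convolution f g x) = \<phi> (convolution f' g' x)"
    using t(1)[OF bilinear_convolution[OF \<phi>]] assms(2-5) by (simp add: functional_convolution[OF \<phi>])
qed

lemma prod_0_left: "prod 0 a = 0" and prod_0_right: "prod a 0 = 0"
proof -
  interpret l: Vector_Spaces.linear scale scale "\<lambda>b. prod b a" by (rule linear_prod_left)
  interpret r: Vector_Spaces.linear scale scale "prod a" by (rule linear_prod_right)
  show "prod 0 a = 0" "prod a 0 = 0" by (rule l.zero, rule r.zero)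
qed

lemma endomorphism_0: "endomorphism (\<lambda>x. 0)"
  by (simp add: Vector_Spaces.linear_iff vector_space_axioms)

text \<open>
  For \<open>x\<close> of degree \<open>n\<close>, a term of \<open>\<Delta>(x)\<close> either has its second factor in degree \<open>0\<close>, where \<open>\<eta>\<epsilon> - id\<close> is zero, or
  its first factor has smaller degree, where the previous power is zero.
\<close>

lemma conv_power_vanishes: "x \<in> C n \<Longrightarrow> n < k \<Longrightarrow> conv_power k x = 0"
proof (induction k arbitrary: n x)
  case (Suc k)
  have "convolution (conv_power k) counit_minus_id x = convolution (\<lambda>u. 0) (\<lambda>v. 0) x"
  proof (rule convolution_homogeneous_cong[OF Suc.prems(1) endomorphism_conv_power
        endomorphism_counit_minus_id endomorphism_0 endomorphism_0])
    fix i u v assume i: "i \<le> n" "u \<in> C i" "v \<in> C (n - i)"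
    show "prod (conv_power k u) (counit_minus_id v) = prod 0 0"
    proof (cases "i = n")
      case True
      then have "counit_minus_id v = 0"
        using i degree_0_eq[of v, symmetric] by (simp add: counit_minus_id_def unit_counit_def)
      then show ?thesis by (simp add: prod_0_right)
    next
      case False
      then have "conv_power k u = 0" using Suc.IH[of u i] Suc.prems(2) i by simp
      then show ?thesis by (simp add: prod_0_left)
    qed
  qed
  then show ?case by (simp add: convolution_def prod_0_left lin_ext_def)
qed simp

lemma counit_minus_id_conv_power: "convolution counit_minus_id (conv_power k) = conv_power (Suc k)"
proof (induction k)
  case 0
  show ?case
    by (simp add: convolution_unit_left convolution_unit_right endomorphism_counit_minus_id)
next
  case (Suc k)
  have "convolution counit_minus_id (conv_power (Suc k)) =
      convolution (convolution counit_minus_id (conv_power k)) counit_minus_id"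
    by (simp add: convolution_assoc endomorphism_counit_minus_id endomorphism_conv_power)
  then show ?case by (simp add: Suc)
qed

text \<open>
  The geometric series of the convolution powers of \<open>\<eta>\<epsilon> - id\<close>, with only finitely many nonzero terms at
  each vector.
\<close>

definition antipode :: "'v \<Rightarrow> 'v" where
  "antipode x = (\<Sum>k | conv_power k x \<noteq> 0. conv_power k x)"

lemma antipode_eq:
  assumes "\<And>k. k > N \<Longrightarrow> conv_power k x = 0"
  shows "antipode x = (\<Sum>k\<le>N. conv_power k x)"
  unfolding antipode_def by (rule sum.mono_neutral_left) (use assms not_le in auto)

lemma conv_power_eventually_0: "\<exists>N. \<forall>k>N. conv_power k x = 0"
proof -
  interpret p: Vector_Spaces.linear scale scale "conv_power k" for k
    by (rule endomorphism_conv_power)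
  let ?A = "{n. component C n x \<noteq> 0}"
  obtain N where N: "\<forall>n\<in>?A. n \<le> N"
    using finite_components[of x] unfolding finite_nat_set_iff_bounded_le by blast
  have "conv_power k x = 0" if "k > N" for k
  proof -
    have "conv_power k (\<Sum>n\<in>?A. component C n x) = 0"
      unfolding p.sum
    proof (intro sum.neutral ballI)
      fix n assume "n \<in> ?A"
      then have "n < k" using N \<open>k > N\<close> by fastforce
      then show "conv_power k (component C n x) = 0"
        by (rule conv_power_vanishes[OF component_in])
    qed
    then show ?thesis by (simp add: sum_components)
  qed
  then show ?thesis by blast
qed

lemma endomorphism_sum_conv_power: "endomorphism (\<lambda>x. \<Sum>k\<le>N. conv_power k x)"
proof -
  interpret p: Vector_Spaces.linear scale scale "conv_power k" for k
    by (rule endomorphism_conv_power)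
  show ?thesis
    by (simp add: Vector_Spaces.linear_iff vector_space_axioms p.add p.scale sum.distrib scale_sum_right)
qed

text \<open>
  On any finite set of vectors the antipode agrees with a single partial sum of the series, which is
  linear.
\<close>

lemma endomorphism_antipode: "endomorphism antipode"
proof -
  have bound: "\<exists>N. \<forall>z\<in>Z. antipode z = (\<Sum>k\<le>N. conv_power k z)" if "finite Z" for Z
  proof -
    have "\<forall>z. \<exists>N. \<forall>k>N. conv_power k z = 0" using conv_power_eventually_0 by blast
    from choice[OF this] obtain M where M: "\<forall>z. \<forall>k>M z. conv_power k z = 0" ..
    \<comment> \<open>the sum of the bounds of the single vectors is a common bound\<close>
    have "antipode z = (\<Sum>k\<le>sum M Z. conv_power k z)" if "z \<in> Z" for z
    proof (rule antipode_eq)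
      fix k assume "k > sum M Z"
      moreover have "M z \<le> sum M Z" using \<open>finite Z\<close> that by (intro member_le_sum) simp_all
      ultimately have "k > M z" by simp
      with M show "conv_power k z = 0" by blast
    qed
    then show ?thesis by blast
  qed
  interpret s: Vector_Spaces.linear scale scale "\<lambda>x. \<Sum>k\<le>N. conv_power k x" for N
    by (rule endomorphism_sum_conv_power)
  show ?thesis
    unfolding Vector_Spaces.linear_iff
  proof (intro conjI allI vector_space_axioms)
    fix x y show "antipode (x + y) = antipode x + antipode y"
    proof -
      obtain N where N: "\<forall>z\<in>{x, y, x + y}. antipode z = (\<Sum>k\<le>N. conv_power k z)"
        using bound[of "{x, y, x + y}"] by blast
      show ?thesis
        unfolding N[THEN bspec, of x, simplified] N[THEN bspec, of y, simplified]
          N[THEN bspec, of "x + y", simplified] by (rule s.add)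
    qed
  next
    fix c x show "antipode (scale c x) = scale c (antipode x)"
    proof -
      obtain N where N: "\<forall>z\<in>{x, scale c x}. antipode z = (\<Sum>k\<le>N. conv_power k z)"
        using bound[of "{x, scale c x}"] by blast
      show ?thesis
        unfolding N[THEN bspec, of x, simplified] N[THEN bspec, of "scale c x", simplified]
        by (rule s.scale)
    qed
  qed
qed

lemma antipode_homogeneous: "x \<in> C i \<Longrightarrow> i \<le> n \<Longrightarrow> antipode x = (\<Sum>k\<le>n. conv_power k x)"
  by (rule antipode_eq, rule conv_power_vanishes[of x i]) auto

text \<open>
  Multiplication by \<open>id = \<eta>\<epsilon> - (\<eta>\<epsilon> - id)\<close> in the convolution algebra.
\<close>

lemma convolution_id_right:
  assumes f: "endomorphism f"
  shows "convolution f (\<lambda>x. x) x = f x - convolution f counit_minus_id x"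
proof -
  interpret r: Vector_Spaces.linear scale scale "prod a" for a by (rule linear_prod_right)
  have "f x = convolution f unit_counit x" by (simp add: convolution_unit_right f)
  also have "\<dots> = convolution f (\<lambda>x. x) x + convolution f counit_minus_id x"
    unfolding convolution_def lin_ext_def
    by (simp add: counit_minus_id_def r.diff scale_right_diff_distrib sum_subtractf)
  finally show ?thesis by simp
qed

lemma convolution_id_left:
  assumes f: "endomorphism f"
  shows "convolution (\<lambda>x. x) f x = f x - convolution counit_minus_id f x"
proof -
  interpret l: Vector_Spaces.linear scale scale "\<lambda>a. prod a b" for b by (rule linear_prod_left)
  have "f x = convolution unit_counit f x" by (simp add: convolution_unit_left f)
  also have "\<dots> = convolution (\<lambda>x. x) f x + convolution counit_minus_id f x"
    unfolding convolution_def lin_ext_def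
    by (simp add: counit_minus_id_def l.diff scale_right_diff_distrib sum_subtractf)
  finally show ?thesis by simp
qed

lemma convolution_sum_left:
  "convolution (\<lambda>x. \<Sum>k\<in>K. f k x) g x = (\<Sum>k\<in>K. convolution (f k) g x)"
proof -
  interpret l: Vector_Spaces.linear scale scale "\<lambda>a. prod a b" for b by (rule linear_prod_left)
  show ?thesis unfolding convolution_def lin_ext_def l.sum scale_sum_right by (rule sum.swap)
qed

lemma convolution_sum_right:
  "convolution g (\<lambda>x. \<Sum>k\<in>K. f k x) x = (\<Sum>k\<in>K. convolution g (f k) x)"
proof -
  interpret r: Vector_Spaces.linear scale scale "prod a" for a by (rule linear_prod_right)
  show ?thesis unfolding convolution_def lin_ext_def r.sum scale_sum_right by (rule sum.swap)
qed

lemma endomorphism_id: "endomorphism (\<lambda>x. x)"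
  by (simp add: Vector_Spaces.linear_iff vector_space_axioms)

lemma endomorphism_eqI:
  assumes "endomorphism f" "endomorphism g" "\<And>n x. x \<in> C n \<Longrightarrow> f x = g x"
  shows "f = g"
proof (intro ext functional_eqI[OF vector_space_axioms])
  fix \<phi> x assume \<phi>: "functional scale \<phi>"
  show "\<phi> (f x) = \<phi> (g x)"
    by (rule functional_homogeneous_eq[OF functional_comp_linear[OF assms(1) \<phi>]
          functional_comp_linear[OF assms(2) \<phi>]]) (simp add: assms(3))
qed

lemma telescoping_conv_powers:
  assumes "x \<in> C n"
  shows "(\<Sum>k\<le>n. conv_power k x - conv_power (Suc k) x) = unit_counit x"
  using sum_telescope[of "\<lambda>k. conv_power k x" n] conv_power_vanishes[OF assms, of "Suc n"] by simp

lemma convolution_antipode_left: "convolution antipode (\<lambda>x. x) = unit_counit"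
proof (rule endomorphism_eqI)
  fix n x assume x: "x \<in> C n"
  have "convolution antipode (\<lambda>x. x) x = convolution (\<lambda>u. \<Sum>k\<le>n. conv_power k u) (\<lambda>x. x) x"
    by (rule convolution_homogeneous_cong[OF x endomorphism_antipode endomorphism_id
          endomorphism_sum_conv_power endomorphism_id])
      (rule arg_cong[where f = "\<lambda>u. prod u _"], erule antipode_homogeneous, assumption)
  also have "\<dots> = (\<Sum>k\<le>n. conv_power k x - conv_power (Suc k) x)"
    by (simp add: convolution_sum_left convolution_id_right endomorphism_conv_power)
  finally show "convolution antipode (\<lambda>x. x) x = unit_counit x"
    by (simp only: telescoping_conv_powers[OF x])
qed (intro endomorphism_convolution endomorphism_antipode endomorphism_id endomorphism_unit_counit)+

lemma convolution_antipode_right: "convolution (\<lambda>x. x) antipode = unit_counit"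
proof (rule endomorphism_eqI)
  fix n x assume x: "x \<in> C n"
  have "convolution (\<lambda>x. x) antipode x = convolution (\<lambda>x. x) (\<lambda>u. \<Sum>k\<le>n. conv_power k u) x"
    by (rule convolution_homogeneous_cong[OF x endomorphism_id endomorphism_antipode
          endomorphism_id endomorphism_sum_conv_power])
      (rule arg_cong[where f = "prod _"], erule antipode_homogeneous, simp)
  also have "\<dots> = (\<Sum>k\<le>n. conv_power k x - conv_power (Suc k) x)"
    by (simp add: convolution_sum_right convolution_id_left endomorphism_conv_power
        counit_minus_id_conv_power del: conv_power.simps)
  finally show "convolution (\<lambda>x. x) antipode x = unit_counit x"
    by (simp only: telescoping_conv_powers[OF x])
qed (intro endomorphism_convolution endomorphism_antipode endomorphism_id endomorphism_unit_counit)+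

end

section \<open>The Hopf algebra of a Hopf operad\<close>

theorem theorem3p4:
  fixes scale :: "'k::field_char_0 \<Rightarrow> 'v::ab_group_add \<Rightarrow> 'v"
    and D :: "nat \<Rightarrow> 'v set"
    and Delta :: "'v \<Rightarrow> ('v list \<Rightarrow>\<^sub>0 'k)"
    and eps :: "'v \<Rightarrow> 'k"
    and gamma :: "'v \<Rightarrow> 'v list \<Rightarrow> 'v"
  assumes "graded_hopf_operad scale D Delta eps gamma"
  shows "hopf_algebra scale Delta eps
           (operad_product scale D Delta gamma) (unit_elem D eps)"
proof -
  interpret graded_hopf_operad scale D Delta eps gamma by fact
  interpret algebra_on_connected_coalgebra scale D Delta eps mult
    by (intro algebra_on_connected_coalgebra.intro algebra_on_connected_coalgebra_axioms.intro
        connected_graded_coalgebra_axioms linear_mult_left linear_mult_right mult_assoc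
        mult_unit_left mult_unit_right)
  have sweedler_f: "ev f (Delta x) = sweedler x (\<lambda>u v. f [u, v])" for f x
    unfolding sweedler_def
    by (rule ev_cong, rule arg_cong[where f = f], rule keys_Delta)
  have bilinear_f: "bilinear (\<lambda>u v. f [u, v])" if "multilinear scale 2 f" for f
    using multilinear_slot[OF that, of "[]" "[_]"] multilinear_slot[OF that, of "[_]" "[]"] by simp
  show ?thesis
  proof (intro hopf_algebra.intro hopf_algebra_axioms.intro coalgebra_axioms linear_mult_left
      linear_mult_right mult_assoc mult_unit_left mult_unit_right eps_mult eps_unit)
    fix a b
    show "tensor_eq scale (Delta (mult a b))
        (lin_ext fscale (\<lambda>p. lin_ext fscale
           (\<lambda>q. pure [mult (p ! 0) (q ! 0), mult (p ! 1) (q ! 1)]) (Delta b)) (Delta a))"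
    proof (rule tensor_eqI[OF vector_space_axioms, of 2])
      fix f assume "multilinear scale 2 f"
      then have "ev f (Delta (mult a b)) = sweedler a (\<lambda>a' a''. sweedler b (\<lambda>b' b''.
          f [mult a' b', mult a'' b'']))"
        unfolding sweedler_f by (intro sweedler_mult bilinear_f)
      also have "\<dots> = ev f (lin_ext fscale (\<lambda>p. lin_ext fscale
           (\<lambda>q. pure [mult (p ! 0) (q ! 0), mult (p ! 1) (q ! 1)]) (Delta b)) (Delta a))"
        unfolding ev_lin_ext ev_pure sweedler_def ..
      finally show "ev f (Delta (mult a b)) = ev f (lin_ext fscale (\<lambda>p. lin_ext fscale
           (\<lambda>q. pure [mult (p ! 0) (q ! 0), mult (p ! 1) (q ! 1)]) (Delta b)) (Delta a))" .
    qed
    show "tensor_eq scale (Delta unit) (pure [unit, unit])"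
      by (rule tensor_eqI[OF vector_space_axioms, of 2])
        (simp add: sweedler_f sweedler_unit[OF bilinear_f])
    show "\<exists>S. Vector_Spaces.linear scale scale S \<and>
        (\<forall>a. lin_ext scale (\<lambda>p. mult (S (p ! 0)) (p ! 1)) (Delta a) = scale (eps a) unit \<and>
             lin_ext scale (\<lambda>p. mult (p ! 0) (S (p ! 1))) (Delta a) = scale (eps a) unit)"
      using endomorphism_antipode convolution_antipode_left convolution_antipode_right
      unfolding fun_eq_iff convolution_def unit_counit_def by blast
  qed
qed

end
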